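(* Let $(M,g,J)$ be a closed connected Kähler surface and suppose that $A\in\mathcal A(g,J)$ has, at least at one point, an eigenvalue $\rho=\mathcal R+\mathrm i\mathcal I$ with $\mathcal I\neq0$. Then $A$ is parallel with respect to the Levi-Civita connection of $g$.
   Context: A Kähler surface: real dimension $4$, $J$ a complex structure, $g$ pseudo-Riemannian of arbitrary signature with $g(JX,Y)=-g(X,JY)$ and $\nabla J=0$ ($\nabla$ Levi-Civita of $g$). $\mathcal A(g,J)$ is the space of smooth $g$-symmetric $(1,1)$-tensor fields $A$ commuting with $J$ such that $\nabla_XA=X^\flat\otimes\Lambda+\Lambda^\flat\otimes X+(JX)^\flat\otimes J\Lambda+(J\Lambda)^\flat\otimes JX$ for all $X$, where $\Lambda=\frac14\operatorname{grad}_g\operatorname{tr}A$ and $X^\flat=g(X,\cdot)$. *)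

theory Defs
  imports "HOL-Analysis.Analysis"
begin

fun Ck_on :: "nat \<Rightarrow> ('a::euclidean_space) set \<Rightarrow> ('a \<Rightarrow> 'b::real_normed_vector) \<Rightarrow> bool" where
  "Ck_on 0 U f = continuous_on U f"
| "Ck_on (Suc k) U f = (f differentiable_on U \<and> continuous_on U f \<and>
      (\<forall>v. Ck_on k U (\<lambda>x. frechet_derivative f (at x) v)))"

definition smooth_on :: "('a::euclidean_space) set \<Rightarrow> ('a \<Rightarrow> 'b::real_normed_vector) \<Rightarrow> bool" where
  "smooth_on U f \<longleftrightarrow> (\<forall>k. Ck_on k U f)"

definition pd :: "(real^4 \<Rightarrow> 'b::real_normed_vector) \<Rightarrow> real^4 \<Rightarrow> 4 \<Rightarrow> 'b" where
  "pd F x i = frechet_derivative F (at x) (axis i 1)"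

definition jac :: "(real^4 \<Rightarrow> real^4) \<Rightarrow> real^4 \<Rightarrow> real^4^4" where
  "jac f x = matrix (frechet_derivative f (at x))"

type_synonym 'm chart = "'m set \<times> ('m \<Rightarrow> real^4)"

definition is_chart :: "'m topology \<Rightarrow> 'm chart \<Rightarrow> bool" where
  "is_chart X c \<longleftrightarrow> openin X (fst c) \<and> open (snd c ` fst c) \<and>
     homeomorphic_map (subtopology X (fst c)) (top_of_set (snd c ` fst c)) (snd c)"

definition cdom :: "'m chart \<Rightarrow> (real^4) set" where
  "cdom c = snd c ` fst c"

definition overlap :: "'m chart \<Rightarrow> 'm chart \<Rightarrow> (real^4) set" where
  "overlap c d = snd c ` (fst c \<inter> fst d)"

definition trans_map :: "'m chart \<Rightarrow> 'm chart \<Rightarrow> real^4 \<Rightarrow> real^4" where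
  "trans_map c d = snd d \<circ> inv_into (fst c) (snd c)"

text \<open>A smooth atlas on X (charts into open subsets of R^4, so no boundary).\<close>
definition smooth_atlas :: "'m topology \<Rightarrow> 'm chart set \<Rightarrow> bool" where
  "smooth_atlas X At \<longleftrightarrow> (\<forall>c\<in>At. is_chart X c) \<and> (\<Union>c\<in>At. fst c) = topspace X \<and>
     (\<forall>c\<in>At. \<forall>d\<in>At. smooth_on (overlap c d) (trans_map c d))"

definition closed_connected_4manifold :: "'m topology \<Rightarrow> 'm chart set \<Rightarrow> bool" where
  "closed_connected_4manifold X At \<longleftrightarrow> Hausdorff_space X \<and> compact_space X \<and>
     connected_space X \<and> smooth_atlas X At"

text \<open>A (1,1)-tensor field is given by its component matrices T c x (row = upper index) in
  every chart c, at coordinate points x; a (0,2)-tensor field likewise by matrices G c x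
  with entries g(d_i,d_j). They are required to be smooth in each chart and compatible
  under changes of coordinates.\<close>

definition smooth_11_field :: "'m chart set \<Rightarrow> ('m chart \<Rightarrow> real^4 \<Rightarrow> real^4^4) \<Rightarrow> bool" where
  "smooth_11_field At T \<longleftrightarrow> (\<forall>c\<in>At. smooth_on (cdom c) (T c)) \<and>
     (\<forall>c\<in>At. \<forall>d\<in>At. \<forall>x\<in>overlap c d.
        T d (trans_map c d x) ** jac (trans_map c d) x = jac (trans_map c d) x ** T c x)"

definition smooth_02_field :: "'m chart set \<Rightarrow> ('m chart \<Rightarrow> real^4 \<Rightarrow> real^4^4) \<Rightarrow> bool" where
  "smooth_02_field At G \<longleftrightarrow> (\<forall>c\<in>At. smooth_on (cdom c) (G c)) \<and>
     (\<forall>c\<in>At. \<forall>d\<in>At. \<forall>x\<in>overlap c d.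
        G c x = transpose (jac (trans_map c d) x) ** G d (trans_map c d x) ** jac (trans_map c d) x)"

definition pseudo_metric :: "'m chart set \<Rightarrow> ('m chart \<Rightarrow> real^4 \<Rightarrow> real^4^4) \<Rightarrow> bool" where
  "pseudo_metric At G \<longleftrightarrow> smooth_02_field At G \<and>
     (\<forall>c\<in>At. \<forall>x\<in>cdom c. transpose (G c x) = G c x \<and> det (G c x) \<noteq> 0)"

text \<open>christ Gc x i is the matrix with (a,k)-entry Gamma^a_{ik}.\<close>
definition christ :: "(real^4 \<Rightarrow> real^4^4) \<Rightarrow> real^4 \<Rightarrow> 4 \<Rightarrow> real^4^4" where
  "christ Gc x i = (\<chi> a k. (1/2) * (\<Sum>l\<in>UNIV. matrix_inv (Gc x) $ a $ l *
      (pd (\<lambda>y. Gc y $ k $ l) x i + pd (\<lambda>y. Gc y $ i $ l) x k - pd (\<lambda>y. Gc y $ i $ k) x l)))"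

definition covd :: "(real^4 \<Rightarrow> real^4^4) \<Rightarrow> (real^4 \<Rightarrow> real^4^4) \<Rightarrow> real^4 \<Rightarrow> 4 \<Rightarrow> real^4^4" where
  "covd Gc Tc x i = pd Tc x i + christ Gc x i ** Tc x - Tc x ** christ Gc x i"

definition nijenhuis :: "(real^4 \<Rightarrow> real^4^4) \<Rightarrow> real^4 \<Rightarrow> 4 \<Rightarrow> 4 \<Rightarrow> 4 \<Rightarrow> real" where
  "nijenhuis Jc x a b c = (\<Sum>d\<in>UNIV.
      Jc x $ d $ b * pd (\<lambda>y. Jc y $ a $ c) x d - Jc x $ d $ c * pd (\<lambda>y. Jc y $ a $ b) x d
    - Jc x $ a $ d * pd (\<lambda>y. Jc y $ d $ c) x b + Jc x $ a $ d * pd (\<lambda>y. Jc y $ d $ b) x c)"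

definition kaehler_surface ::
  "'m topology \<Rightarrow> 'm chart set \<Rightarrow> ('m chart \<Rightarrow> real^4 \<Rightarrow> real^4^4) \<Rightarrow> ('m chart \<Rightarrow> real^4 \<Rightarrow> real^4^4) \<Rightarrow> bool" where
  "kaehler_surface X At G J \<longleftrightarrow> pseudo_metric At G \<and> smooth_11_field At J \<and>
     (\<forall>c\<in>At. \<forall>x\<in>cdom c.
        J c x ** J c x = - mat 1 \<and>
        (\<forall>a b e. nijenhuis (J c) x a b e = 0) \<and>
        transpose (J c x) ** G c x = - (G c x ** J c x) \<and>
        (\<forall>i. covd (G c) (J c) x i = 0))"

definition outer :: "real^4 \<Rightarrow> real^4 \<Rightarrow> real^4^4" where
  "outer u v = (\<chi> i j. u $ i * v $ j)"

definition Lam :: "(real^4 \<Rightarrow> real^4^4) \<Rightarrow> (real^4 \<Rightarrow> real^4^4) \<Rightarrow> real^4 \<Rightarrow> real^4" where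
  "Lam Gc Ac x = (1/4) *\<^sub>R (matrix_inv (Gc x) *v (\<chi> b. pd (\<lambda>y. trace (Ac y)) x b))"

text \<open>Membership in A(g,J): g-symmetric, commuting with J, smooth, and
  nabla_X A = X^b (x) Lambda + Lambda^b (x) X + (JX)^b (x) J Lambda + (J Lambda)^b (x) JX,
  tested on the coordinate vector fields X = d_i (the identity is tensorial in X).\<close>
definition in_AgJ ::
  "'m chart set \<Rightarrow> ('m chart \<Rightarrow> real^4 \<Rightarrow> real^4^4) \<Rightarrow> ('m chart \<Rightarrow> real^4 \<Rightarrow> real^4^4)
    \<Rightarrow> ('m chart \<Rightarrow> real^4 \<Rightarrow> real^4^4) \<Rightarrow> bool" where
  "in_AgJ At G J A \<longleftrightarrow> smooth_11_field At A \<and>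
     (\<forall>c\<in>At. \<forall>x\<in>cdom c.
        G c x ** A c x = transpose (A c x) ** G c x \<and>
        A c x ** J c x = J c x ** A c x \<and>
        (\<forall>i. let L = Lam (G c) (A c) x; Xi = axis i 1; Gx = G c x; Jx = J c x in
           covd (G c) (A c) x i =
             outer L (Gx *v Xi) + outer Xi (Gx *v L)
             + outer (Jx *v L) (Gx *v (Jx *v Xi)) + outer (Jx *v Xi) (Gx *v (Jx *v L))))"

definition complex_eigenvalue :: "real^4^4 \<Rightarrow> complex \<Rightarrow> bool" where
  "complex_eigenvalue M \<rho> \<longleftrightarrow> (\<exists>v::complex^4. v \<noteq> 0 \<and>
     (\<chi> i. \<Sum>j\<in>UNIV. complex_of_real (M $ i $ j) * v $ j) = \<rho> *s v)"

end

theory Submission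
  imports Defs
begin

text \<open>
  Write \<open>R = tr A / 4\<close>, \<open>B = A - R Id\<close> and \<open>E = - tr B\<^sup>2 / 4\<close>. As \<open>A\<close> is \<open>J\<close>-linear and
  \<open>g\<close>-symmetric, its complex trace and determinant are real, so Cayley-Hamilton gives
  \<open>B\<^sup>2 = -E Id\<close>, and \<open>A\<close> has a non-real eigenvalue \<open>R + i \<surd>E\<close> exactly where \<open>E > 0\<close>. The
  equation for \<open>\<nabla>A\<close> yields \<open>dE = -2 dR \<circ> B\<close>: where \<open>E > 0\<close>, the function \<open>R + i \<surd>E\<close> is
  holomorphic for the almost complex structure \<open>B / \<surd>E\<close>. Hence \<open>E\<close> solves a linear elliptic
  equation without zeroth order term there, and by Hopf's strong maximum principle the set where
  \<open>E\<close> attains its positive maximum is open. It is also closed and \<open>M\<close> is connected, so \<open>E\<close> is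
  constant; then \<open>dR = 0\<close>, \<open>\<Lambda> = 0\<close> and \<open>\<nabla>A = 0\<close>.
\<close>

section \<open>Second derivatives\<close>

lemma has_real_derivative_along_line:
  fixes f :: "'a::real_normed_vector \<Rightarrow> real"
  assumes "(f has_derivative f') (at (p + s *\<^sub>R v))"
  shows "((\<lambda>s. f (p + s *\<^sub>R v)) has_real_derivative f' v) (at s)"
proof -
  have "((\<lambda>s. p + s *\<^sub>R v) has_derivative (\<lambda>h. h *\<^sub>R v)) (at s)"
    by (auto intro!: derivative_eq_intros)
  from has_derivative_compose[OF this assms]
  have "((\<lambda>s. f (p + s *\<^sub>R v)) has_derivative (\<lambda>h. f' (h *\<^sub>R v))) (at s)" .
  moreover have "f' (h *\<^sub>R v) = f' v * h" for h
    using linear_scale[OF has_derivative_linear[OF assms]] by simp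
  ultimately show ?thesis by (simp add: has_field_derivative_def)
qed

lemma second_difference_mean_value:
  fixes f :: "'a::real_normed_vector \<Rightarrow> real"
  assumes "t > 0"
    and f': "\<And>s. 0 \<le> s \<Longrightarrow> s \<le> t \<Longrightarrow>
      (f has_derivative f' (x + s *\<^sub>R v)) (at (x + s *\<^sub>R v)) \<and>
      (f has_derivative f' (x + t *\<^sub>R w + s *\<^sub>R v)) (at (x + t *\<^sub>R w + s *\<^sub>R v))"
  obtains s where "0 < s" "s < t"
    "f (x + t *\<^sub>R v + t *\<^sub>R w) - f (x + t *\<^sub>R v) - f (x + t *\<^sub>R w) + f x
      = t * (f' (x + t *\<^sub>R w + s *\<^sub>R v) v - f' (x + s *\<^sub>R v) v)"
proof -
  let ?g = "\<lambda>s. f (x + t *\<^sub>R w + s *\<^sub>R v) - f (x + s *\<^sub>R v)"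
  have "DERIV ?g s :> f' (x + t *\<^sub>R w + s *\<^sub>R v) v - f' (x + s *\<^sub>R v) v" if "0 \<le> s" "s \<le> t" for s
    using f'[OF that] by (intro DERIV_diff has_real_derivative_along_line) auto
  from MVT2[OF \<open>t > 0\<close> this] obtain s where "0 < s" "s < t"
    "?g t - ?g 0 = t * (f' (x + t *\<^sub>R w + s *\<^sub>R v) v - f' (x + s *\<^sub>R v) v)"
    by auto
  then show ?thesis using that by (simp add: algebra_simps)
qed

lemma second_difference_error:
  fixes f :: "'a::real_normed_vector \<Rightarrow> real"
  assumes "bounded_linear D" "\<epsilon> \<ge> 0" "t > 0" "t * (2 * norm v + norm w) < r"
    and f': "\<And>y. y \<in> ball x r \<Longrightarrow> (f has_derivative f' y) (at y)"
    and f'': "\<And>y. y \<in> ball x r \<Longrightarrow> \<bar>f' y v - f' x v - D (y - x)\<bar> \<le> \<epsilon> * norm (y - x)"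
  shows "\<bar>f (x + t *\<^sub>R v + t *\<^sub>R w) - f (x + t *\<^sub>R v) - f (x + t *\<^sub>R w) + f x - t\<^sup>2 * D w\<bar>
    \<le> \<epsilon> * (2 * norm v + norm w) * t\<^sup>2"
proof -
  interpret D: bounded_linear D by fact
  have steps: "norm (s *\<^sub>R v) \<le> t * norm v"
      "norm (t *\<^sub>R w + s *\<^sub>R v) \<le> t * (norm v + norm w)"
    and in_ball: "x + s *\<^sub>R v \<in> ball x r" "x + t *\<^sub>R w + s *\<^sub>R v \<in> ball x r"
    if s: "0 \<le> s" "s \<le> t" for s
  proof -
    show v: "norm (s *\<^sub>R v) \<le> t * norm v" using s by (auto intro: mult_right_mono)
    then show vw: "norm (t *\<^sub>R w + s *\<^sub>R v) \<le> t * (norm v + norm w)"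
      using norm_triangle_ineq[of "t *\<^sub>R w" "s *\<^sub>R v"] \<open>t > 0\<close> by (simp add: distrib_left)
    have "0 \<le> t * norm v" "0 \<le> t * norm w" "2 * (t * norm v) + t * norm w < r"
      using assms(3,4) by (simp_all add: distrib_left)
    with v vw have "norm (s *\<^sub>R v) < r" "norm (t *\<^sub>R w + s *\<^sub>R v) < r"
      unfolding distrib_left by linarith+
    moreover have "x + h \<in> ball x r \<longleftrightarrow> norm h < r" for h by (simp add: dist_norm)
    ultimately show "x + s *\<^sub>R v \<in> ball x r" "x + t *\<^sub>R w + s *\<^sub>R v \<in> ball x r"
      by (simp_all only: add.assoc)
  qed
  obtain s where s: "0 < s" "s < t"
    "f (x + t *\<^sub>R v + t *\<^sub>R w) - f (x + t *\<^sub>R v) - f (x + t *\<^sub>R w) + f x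
      = t * (f' (x + t *\<^sub>R w + s *\<^sub>R v) v - f' (x + s *\<^sub>R v) v)"
    by (rule second_difference_mean_value[OF \<open>t > 0\<close>, of f f' x v w]) (use f' in_ball in blast)+
  let ?p = "t *\<^sub>R w + s *\<^sub>R v" and ?q = "s *\<^sub>R v"
  let ?rem = "\<lambda>h. f' (x + h) v - f' x v - D h"
  have "\<bar>?rem ?p\<bar> \<le> \<epsilon> * norm ?p" "\<bar>?rem ?q\<bar> \<le> \<epsilon> * norm ?q"
    using f''[of "x + ?p"] f''[of "x + ?q"] in_ball[of s] s(1,2) by (simp_all add: add.assoc)
  then have "\<bar>?rem ?p - ?rem ?q\<bar> \<le> \<epsilon> * (norm ?p + norm ?q)" unfolding distrib_left by linarith
  also have "\<dots> \<le> \<epsilon> * ((2 * norm v + norm w) * t)"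
    using steps[of s] s(1,2) \<open>\<epsilon> \<ge> 0\<close> by (intro mult_left_mono) (simp_all add: algebra_simps)
  finally have "t * \<bar>?rem ?p - ?rem ?q\<bar> \<le> t * (\<epsilon> * ((2 * norm v + norm w) * t))"
    using \<open>t > 0\<close> by (intro mult_left_mono) auto
  moreover have "t * (f' (x + t *\<^sub>R w + s *\<^sub>R v) v - f' (x + s *\<^sub>R v) v) - t\<^sup>2 * D w
      = t * (?rem ?p - ?rem ?q)"
    by (simp add: D.add D.scaleR add.assoc power2_eq_square right_diff_distrib distrib_left)
  ultimately show ?thesis
    unfolding s(3) using \<open>t > 0\<close> by (simp add: abs_mult power2_eq_square mult_ac)
qed

lemma second_difference_quotient_tendsto:
  fixes f :: "'a::real_normed_vector \<Rightarrow> real"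
  assumes f': "\<forall>\<^sub>F y in nhds x. (f has_derivative f' y) (at y)"
    and f'': "((\<lambda>y. f' y v) has_derivative D) (at x)"
  shows "((\<lambda>t. (f (x + t *\<^sub>R v + t *\<^sub>R w) - f (x + t *\<^sub>R v) - f (x + t *\<^sub>R w) + f x) / t\<^sup>2)
    \<longlongrightarrow> D w) (at_right 0)" (is "((\<lambda>t. ?\<Delta> t / t\<^sup>2) \<longlongrightarrow> _) _")
proof (rule tendstoI)
  fix e :: real assume "e > 0"
  define K where "K = 2 * norm v + norm w"
  have "K \<ge> 0" by (simp add: K_def)
  define \<epsilon> where "\<epsilon> = e / (K + 1)"
  have "\<epsilon> > 0" using \<open>e > 0\<close> \<open>K \<ge> 0\<close> by (simp add: \<epsilon>_def)
  have D: "bounded_linear D" by (rule has_derivative_bounded_linear[OF f''])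
  have "\<forall>\<^sub>F y in at x. \<bar>f' y v - f' x v - D (y - x)\<bar> \<le> \<epsilon> * norm (y - x)"
    using f'' \<open>\<epsilon> > 0\<close> unfolding has_derivative_within_alt2 real_norm_def by blast
  then have "\<forall>\<^sub>F y in nhds x. \<bar>f' y v - f' x v - D (y - x)\<bar> \<le> \<epsilon> * norm (y - x)"
    by (simp add: eventually_nhds_conv_at linear_simps[OF D])
  from eventually_conj[OF f' this] obtain r where "r > 0"
    and r: "\<And>y. y \<in> ball x r \<Longrightarrow> (f has_derivative f' y) (at y)"
      "\<And>y. y \<in> ball x r \<Longrightarrow> \<bar>f' y v - f' x v - D (y - x)\<bar> \<le> \<epsilon> * norm (y - x)"
    unfolding eventually_nhds_metric mem_ball dist_commute[of x] by blast
  have "dist (?\<Delta> t / t\<^sup>2) (D w) < e" if t: "0 < t" "t < r / (K + 1)" for t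
  proof -
    have "t * (2 * norm v + norm w) < r"
      using t \<open>K \<ge> 0\<close> by (simp add: K_def[symmetric] less_divide_eq distrib_left)
    then have "\<bar>?\<Delta> t - t\<^sup>2 * D w\<bar> \<le> \<epsilon> * K * t\<^sup>2"
      using second_difference_error[OF D _ t(1) _ r] \<open>\<epsilon> > 0\<close> by (simp add: K_def)
    also have "\<dots> < e * t\<^sup>2"
      using t(1) \<open>e > 0\<close> \<open>K \<ge> 0\<close> by (simp add: \<epsilon>_def divide_less_eq)
    finally have "\<bar>?\<Delta> t - t\<^sup>2 * D w\<bar> / t\<^sup>2 < e" using t(1) by (simp add: divide_less_eq)
    moreover have "?\<Delta> t / t\<^sup>2 - D w = (?\<Delta> t - t\<^sup>2 * D w) / t\<^sup>2"
      using t(1) by (simp add: diff_divide_distrib)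
    ultimately show ?thesis by (simp only: dist_real_def abs_divide abs_power2)
  qed
  then show "\<forall>\<^sub>F t in at_right 0. dist (?\<Delta> t / t\<^sup>2) (D w) < e"
    unfolding eventually_at_right_field using \<open>r > 0\<close> \<open>K \<ge> 0\<close>
    by (intro exI[of _ "r / (K + 1)"]) simp
qed

lemma second_derivative_symmetric:
  fixes f :: "'a::real_normed_vector \<Rightarrow> real"
  assumes "\<forall>\<^sub>F y in nhds x. (f has_derivative f' y) (at y)"
    and "((\<lambda>y. f' y v) has_derivative D\<^sub>v) (at x)" "((\<lambda>y. f' y w) has_derivative D\<^sub>w) (at x)"
  shows "D\<^sub>v w = D\<^sub>w v"
  using second_difference_quotient_tendsto[OF assms(1,2), of w]
    second_difference_quotient_tendsto[OF assms(1,3), of v]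
  by (intro tendsto_unique[OF trivial_limit_at_right_real]) (simp_all add: algebra_simps)

lemma second_derivative_nonpos_at_local_max:
  fixes f :: "'a::real_normed_vector \<Rightarrow> real"
  assumes f': "\<forall>\<^sub>F y in nhds x. (f has_derivative f' y) (at y)"
    and f'': "((\<lambda>y. f' y v) has_derivative D) (at x)"
    and max: "\<forall>\<^sub>F y in nhds x. f y \<le> f x"
  shows "D v \<le> 0"
proof -
  have max_line: "\<forall>\<^sub>F t in at_right 0. f (x + t *\<^sub>R h) \<le> f x" for h
  proof -
    have "((\<lambda>t. x + t *\<^sub>R h) \<longlongrightarrow> x + 0 *\<^sub>R h) (at_right 0)" by (intro tendsto_intros)
    then show ?thesis using eventually_compose_filterlim[OF max] by simp
  qed
  have "\<forall>\<^sub>F t in at_right 0.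
      0 \<le> (f (x + t *\<^sub>R v + t *\<^sub>R (- v)) - f (x + t *\<^sub>R v) - f (x + t *\<^sub>R (- v)) + f x) / t\<^sup>2"
    using max_line[of v] max_line[of "- v"] by eventually_elim simp
  then have "D (- v) \<ge> 0"
    using tendsto_lowerbound[OF second_difference_quotient_tendsto[OF f' f'']] by simp
  then show ?thesis using linear_neg[OF has_derivative_linear[OF f'']] by simp
qed

section \<open>Smooth functions\<close>

lemma smooth_on_imp_continuous_on: "smooth_on U f \<Longrightarrow> continuous_on U f"
  unfolding smooth_on_def by (drule spec[of _ 0]) simp

lemma smooth_on_frechet_derivative:
  assumes "smooth_on U f"
  shows "smooth_on U (\<lambda>x. frechet_derivative f (at x) v)"
proof -
  have "Ck_on (Suc k) U f" for k using assms unfolding smooth_on_def by blast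
  then show ?thesis by (simp add: smooth_on_def)
qed

lemma smooth_on_has_derivative:
  assumes "smooth_on U f" "open U" "x \<in> U"
  shows "(f has_derivative frechet_derivative f (at x)) (at x)"
proof -
  have "Ck_on (Suc 0) U f" using assms(1) unfolding smooth_on_def by blast
  then show ?thesis
    using assms(2,3) by (simp add: differentiable_on_eq_differentiable_at frechet_derivative_works)
qed

lemma Ck_on_cong:
  assumes "open U" "\<And>x. x \<in> U \<Longrightarrow> f x = g x" "Ck_on k U f"
  shows "Ck_on k U g"
  using assms(2,3)
proof (induction k arbitrary: f g)
  case 0
  then show ?case by (simp cong: continuous_on_cong)
next
  case (Suc k)
  have derivative: "(g has_derivative frechet_derivative f (at x)) (at x)" if "x \<in> U" for x
  proof (rule has_derivative_transform_within_open[OF _ \<open>open U\<close> that Suc.prems(1)])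
    show "(f has_derivative frechet_derivative f (at x)) (at x)"
      using Suc.prems(2) \<open>open U\<close> that
      by (simp add: differentiable_on_eq_differentiable_at frechet_derivative_works)
  qed
  have "Ck_on k U (\<lambda>x. frechet_derivative g (at x) v)" for v
  proof (rule Suc.IH)
    show "Ck_on k U (\<lambda>x. frechet_derivative f (at x) v)" using Suc.prems(2) by simp
    show "frechet_derivative f (at x) v = frechet_derivative g (at x) v" if "x \<in> U" for x
      by (simp only: frechet_derivative_at[OF derivative[OF that]])
  qed
  moreover have "g differentiable_on U"
    using derivative \<open>open U\<close>
    by (auto simp: differentiable_on_eq_differentiable_at differentiable_def)
  moreover have "continuous_on U g" using Suc.prems by (simp cong: continuous_on_cong)
  ultimately show ?case by simp
qed

lemma Ck_on_bounded_linear: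
  assumes "open U" "bounded_linear T" "Ck_on k U f"
  shows "Ck_on k U (\<lambda>x. T (f x))"
  using assms(3)
proof (induction k arbitrary: f)
  case 0
  then show ?case by (simp add: bounded_linear.continuous_on[OF assms(2)])
next
  case (Suc k)
  have derivative:
    "((\<lambda>x. T (f x)) has_derivative (\<lambda>v. T (frechet_derivative f (at x) v))) (at x)" if "x \<in> U" for x
    using Suc.prems \<open>open U\<close> that
    by (intro bounded_linear.has_derivative[OF assms(2)])
      (simp add: differentiable_on_eq_differentiable_at frechet_derivative_works)
  have "Ck_on k U (\<lambda>x. frechet_derivative (\<lambda>y. T (f y)) (at x) v)" for v
  proof (rule Ck_on_cong[OF \<open>open U\<close>])
    show "Ck_on k U (\<lambda>x. T (frechet_derivative f (at x) v))"
      using Suc.prems by (intro Suc.IH) simp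
    show "T (frechet_derivative f (at x) v) = frechet_derivative (\<lambda>y. T (f y)) (at x) v"
      if "x \<in> U" for x
      by (simp only: frechet_derivative_at[OF derivative[OF that], symmetric])
  qed
  moreover have "(\<lambda>x. T (f x)) differentiable_on U"
    using derivative \<open>open U\<close>
    by (auto simp: differentiable_on_eq_differentiable_at differentiable_def)
  ultimately show ?case
    using Suc.prems by (simp add: bounded_linear.continuous_on[OF assms(2)])
qed

lemma smooth_on_bounded_linear:
  "open U \<Longrightarrow> bounded_linear T \<Longrightarrow> smooth_on U f \<Longrightarrow> smooth_on U (\<lambda>x. T (f x))"
  unfolding smooth_on_def by (blast intro: Ck_on_bounded_linear)

definition gradient :: "('a::euclidean_space \<Rightarrow> real) \<Rightarrow> 'a \<Rightarrow> 'a" where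
  "gradient f x = (\<Sum>k\<in>Basis. frechet_derivative f (at x) k *\<^sub>R k)"

lemma smooth_on_has_derivative_inner_gradient:
  assumes "smooth_on U f" "open U" "x \<in> U"
  shows "(f has_derivative (\<lambda>v. gradient f x \<bullet> v)) (at x)"
proof -
  have "frechet_derivative f (at x) = (\<lambda>v. gradient f x \<bullet> v)"
  proof
    show "frechet_derivative f (at x) v = gradient f x \<bullet> v" for v
      using Linear_Algebra.linear_componentwise[OF has_derivative_linear
          [OF smooth_on_has_derivative[OF assms]], of v 1]
      by (simp add: gradient_def inner_sum_left inner_commute[of v] mult.commute)
  qed
  then show ?thesis using smooth_on_has_derivative[OF assms] by simp
qed

lemma smooth_on_gradient_has_derivative:
  assumes "smooth_on U f" "open U" "x \<in> U"
  shows "(gradient f has_derivative frechet_derivative (gradient f) (at x)) (at x)"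
proof -
  have "(\<lambda>y. frechet_derivative f (at y) k) differentiable at x" for k
    using smooth_on_has_derivative[OF smooth_on_frechet_derivative[OF assms(1)] assms(2,3)]
    by (rule differentiableI)
  then have "(\<lambda>y. \<Sum>k\<in>Basis. frechet_derivative f (at y) k *\<^sub>R k) differentiable at x"
    by (intro differentiable_sum ballI differentiable_scaleR differentiable_const) auto
  then show ?thesis by (simp add: gradient_def[abs_def] frechet_derivative_works)
qed

lemma derivative_of_gradient_symmetric:
  assumes "smooth_on U f" "open U" "x \<in> U"
  shows "frechet_derivative (gradient f) (at x) v \<bullet> w =
    frechet_derivative (gradient f) (at x) w \<bullet> v"
proof -
  have first: "\<forall>\<^sub>F y in nhds x. (f has_derivative (\<lambda>v. gradient f y \<bullet> v)) (at y)"
    using eventually_nhds_in_open[OF assms(2,3)]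
    by eventually_elim (rule smooth_on_has_derivative_inner_gradient[OF assms(1,2)])
  have hessian: "((\<lambda>y. gradient f y \<bullet> v) has_derivative
      (\<lambda>h. frechet_derivative (gradient f) (at x) h \<bullet> v)) (at x)" for v
    by (rule has_derivative_inner_left[OF smooth_on_gradient_has_derivative[OF assms]])
  show ?thesis by (rule second_derivative_symmetric[OF first hessian hessian])
qed

section \<open>The strong maximum principle\<close>

definition twice_differentiable_on ::
  "('a::real_normed_vector \<Rightarrow> real) \<Rightarrow> ('a \<Rightarrow> 'a \<Rightarrow> real) \<Rightarrow> ('a \<Rightarrow> 'a \<Rightarrow> 'a \<Rightarrow> real) \<Rightarrow> 'a set \<Rightarrow> bool" where
  "twice_differentiable_on u u' u'' U \<longleftrightarrow> (\<forall>x\<in>U. (u has_derivative u' x) (at x) \<and>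
     (\<forall>v. ((\<lambda>y. u' y v) has_derivative u'' x v) (at x)))"

lemma twice_differentiable_on_imp_continuous_on:
  "twice_differentiable_on u u' u'' U \<Longrightarrow> continuous_on U u"
  unfolding twice_differentiable_on_def
  by (metis continuous_at_imp_continuous_on has_derivative_continuous)

lemma twice_differentiable_on_add_cmult:
  assumes "twice_differentiable_on u u' u'' U" "twice_differentiable_on w w' w'' U"
  shows "twice_differentiable_on (\<lambda>x. u x + c * w x) (\<lambda>x v. u' x v + c * w' x v)
    (\<lambda>x v h. u'' x v h + c * w'' x v h) U"
  using assms unfolding twice_differentiable_on_def
  by (intro ballI conjI allI has_derivative_add has_derivative_mult_right) auto

definition gaussian :: "real \<Rightarrow> 'a::real_inner \<Rightarrow> 'a \<Rightarrow> real" where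
  "gaussian \<alpha> y x = exp (- \<alpha> * ((x - y) \<bullet> (x - y)))"

definition gaussian' :: "real \<Rightarrow> 'a::real_inner \<Rightarrow> 'a \<Rightarrow> 'a \<Rightarrow> real" where
  "gaussian' \<alpha> y x v = - 2 * \<alpha> * ((x - y) \<bullet> v) * gaussian \<alpha> y x"

definition gaussian'' :: "real \<Rightarrow> 'a::real_inner \<Rightarrow> 'a \<Rightarrow> 'a \<Rightarrow> 'a \<Rightarrow> real" where
  "gaussian'' \<alpha> y x v h =
     gaussian \<alpha> y x * (4 * \<alpha>\<^sup>2 * ((x - y) \<bullet> v) * ((x - y) \<bullet> h) - 2 * \<alpha> * (h \<bullet> v))"

lemma twice_differentiable_on_gaussian:
  "twice_differentiable_on (\<lambda>x. gaussian \<alpha> y x - K) (gaussian' \<alpha> y) (gaussian'' \<alpha> y) U"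
proof -
  have derivative: "(gaussian \<alpha> y has_derivative gaussian' \<alpha> y x) (at x)" for x
    unfolding gaussian_def[abs_def] gaussian'_def
    by (auto intro!: derivative_eq_intros simp: inner_commute)
  have "((\<lambda>x. gaussian' \<alpha> y x v) has_derivative gaussian'' \<alpha> y x v) (at x)" for x v
    unfolding gaussian'_def gaussian''_def
    by (auto intro!: derivative_eq_intros derivative
        simp: gaussian'_def inner_commute power2_eq_square algebra_simps)
  then show ?thesis
    using has_derivative_diff[OF derivative has_derivative_const]
    by (simp add: twice_differentiable_on_def)
qed

lemma gaussian_eq_exp_dist: "gaussian \<alpha> y x = exp (- \<alpha> * (dist y x)\<^sup>2)"
  by (simp add: gaussian_def dist_norm norm_minus_commute[of y] flip: power2_norm_eq_inner)

lemma gaussian_less_iff: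
  assumes "\<alpha> > 0" "d \<ge> 0"
  shows "gaussian \<alpha> y x < exp (- \<alpha> * d\<^sup>2) \<longleftrightarrow> d < dist y x"
  using assms by (simp add: gaussian_eq_exp_dist power_mono_iff flip: not_le)

lemma exists_perturbation_below:
  fixes u w :: "'a::topological_space \<Rightarrow> real"
  assumes "compact S" "continuous_on S u" "continuous_on S w"
    and le: "\<And>x. x \<in> S \<Longrightarrow> u x \<le> M"
    and neg: "\<And>x. x \<in> S \<Longrightarrow> u x = M \<Longrightarrow> w x < 0"
  obtains \<epsilon> where "\<epsilon> > 0" "\<And>x. x \<in> S \<Longrightarrow> u x + \<epsilon> * w x < M"
proof (cases "S = {}")
  case True
  then show ?thesis using that[of 1] by simp
next
  case False
  obtain p where p: "p \<in> S" "\<And>x. x \<in> S \<Longrightarrow> w x \<le> w p"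
    using continuous_attains_sup[OF assms(1) False assms(3)] by blast
  have "continuous_on S (\<lambda>x. max (M - u x) (- w x))"
    using assms(2,3) by (intro continuous_intros)
  then obtain q where q: "q \<in> S"
    "\<And>x. x \<in> S \<Longrightarrow> max (M - u q) (- w q) \<le> max (M - u x) (- w x)"
    using continuous_attains_inf[OF assms(1) False] by blast
  define m where "m = max (M - u q) (- w q)"
  have "m > 0"
    using le[OF q(1)] neg[OF q(1)] by (cases "u q = M") (auto simp: m_def less_max_iff_disj)
  define \<epsilon> where "\<epsilon> = m / (\<bar>w p\<bar> + 1)"
  show ?thesis
  proof (rule that)
    show "\<epsilon> > 0" using \<open>m > 0\<close> by (simp add: \<epsilon>_def add_nonneg_pos)
    fix x assume x: "x \<in> S"
    show "u x + \<epsilon> * w x < M"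
    proof (cases "w x < 0")
      case True
      then have "\<epsilon> * w x < 0" using \<open>\<epsilon> > 0\<close> by (simp add: mult_pos_neg)
      then show ?thesis using le[OF x] by linarith
    next
      case False
      have "\<epsilon> * w x < \<epsilon> * (\<bar>w p\<bar> + 1)" using p(2)[OF x] \<open>\<epsilon> > 0\<close> by simp
      also have "\<dots> = m" by (simp add: \<epsilon>_def)
      also have "m \<le> M - u x"
        using q(2)[OF x] False \<open>m > 0\<close> unfolding m_def[symmetric] by (auto simp: le_max_iff_disj)
      finally show ?thesis by simp
    qed
  qed
qed

lemma dist_less_if_mem_half_ball:
  fixes q x y :: "'a::real_inner"
  assumes "x \<in> cball (midpoint y q) (dist y q / 2)" "x \<noteq> q"
  shows "dist y x < dist y q"
proof -
  have parallelogram: "(norm (f + e))\<^sup>2 + (norm (f - e))\<^sup>2 = 2 * (norm f)\<^sup>2 + 2 * (norm e)\<^sup>2"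
    for e f :: 'a
    by (simp add: power2_norm_eq_inner inner_add_left inner_add_right inner_diff_left
        inner_diff_right)
  define m e where "m = midpoint y q" and "e = m - y"
  have "q = m + e"
    using midpoint_plus_self[of y q] unfolding m_def e_def by (simp add: algebra_simps)
  then have sum_diff: "(x - m) + e = x - y" "(x - m) - e = x - q" by (simp_all add: e_def)
  have "(dist y x)\<^sup>2 + (dist q x)\<^sup>2 = 2 * (dist m x)\<^sup>2 + 2 * (dist y m)\<^sup>2"
    using parallelogram[of "x - m" e] unfolding sum_diff
    by (simp add: dist_norm norm_minus_commute[of _ x] norm_minus_commute[of y] e_def)
  also have "\<dots> \<le> 2 * (dist y q / 2)\<^sup>2 + 2 * (dist y q / 2)\<^sup>2"
    using assms(1) by (intro add_mono mult_left_mono power_mono) (auto simp: dist_midpoint m_def)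
  finally have "(dist y x)\<^sup>2 + (dist q x)\<^sup>2 \<le> (dist y q)\<^sup>2" by (simp add: power_divide)
  moreover have "(dist q x)\<^sup>2 > 0" using assms(2) by simp
  ultimately have "(dist y x)\<^sup>2 < (dist y q)\<^sup>2" by linarith
  then show ?thesis by (rule power_less_imp_less_base) simp
qed

text \<open>A ball around a point of the complement first meets the set at a nearest point; the ball with
  half the radius touches the set there only.\<close>

lemma exists_touching_ball:
  fixes S :: "'a::euclidean_space set"
  assumes "open U" "closedin (top_of_set U) S" "\<not> open S"
  obtains y q where "q \<in> S" "y \<noteq> q" "cball y (dist y q) \<inter> S = {q}"
proof -
  have "S \<subseteq> U" using closedin_imp_subset[OF assms(2)] .
  obtain p where p: "p \<in> S" "\<And>e. e > 0 \<Longrightarrow> \<not> ball p e \<subseteq> S"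
    using \<open>\<not> open S\<close> by (auto simp: open_contains_ball)
  obtain r where r: "r > 0" "cball p r \<subseteq> U"
    using \<open>open U\<close> \<open>S \<subseteq> U\<close> p(1) open_contains_cball by blast
  obtain y where y: "dist p y < r / 2" "y \<notin> S"
    using p(2)[of "r / 2"] r(1) by (auto simp: subset_iff)
  have "closed (S \<inter> cball p r)"
  proof -
    obtain C where "closed C" "S = U \<inter> C" using assms(2) by (auto simp: closedin_closed)
    moreover from this have "S \<inter> cball p r = C \<inter> cball p r" using r(2) by auto
    ultimately show ?thesis by (simp add: closed_Int)
  qed
  moreover have "p \<in> S \<inter> cball p r" using p(1) r(1) by simp
  ultimately obtain q where q: "q \<in> S \<inter> cball p r" "\<And>x. x \<in> S \<inter> cball p r \<Longrightarrow> dist y q \<le> dist y x"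
    using distance_attains_inf[of "S \<inter> cball p r" y] by blast
  have nearest: "x \<notin> S" if "dist y x < dist y q" for x
  proof
    assume "x \<in> S"
    have "dist y q \<le> dist y p" using q(2) p(1) r(1) by simp
    then have "dist p x \<le> r" using y(1) that dist_triangle[of p x y] by (simp add: dist_commute)
    then show False using q(2)[of x] \<open>x \<in> S\<close> that by simp
  qed
  let ?m = "midpoint y q"
  show ?thesis
  proof (rule that)
    show "q \<in> S" using q(1) by simp
    show "?m \<noteq> q" using y(2) \<open>q \<in> S\<close> by auto
    have "x = q" if "x \<in> cball ?m (dist ?m q)" "x \<in> S" for x
      using dist_less_if_mem_half_ball[of x y q] nearest[of x] that by (auto simp: dist_midpoint)
    then show "cball ?m (dist ?m q) \<inter> S = {q}" using \<open>q \<in> S\<close> by auto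
  qed
qed

locale elliptic_operator =
  fixes U :: "'a::euclidean_space set" and I :: "'i set"
    and a :: "'i \<Rightarrow> 'a \<Rightarrow> real" and \<sigma> :: "'i \<Rightarrow> 'a \<Rightarrow> 'a" and b :: "'a \<Rightarrow> 'a"
  assumes open_domain: "open U"
    and nonneg: "\<And>i x. i \<in> I \<Longrightarrow> x \<in> U \<Longrightarrow> 0 \<le> a i x"
    and elliptic: "\<And>x \<xi>. x \<in> U \<Longrightarrow> \<xi> \<noteq> 0 \<Longrightarrow> 0 < (\<Sum>i\<in>I. a i x * (\<sigma> i x \<bullet> \<xi>)\<^sup>2)"
    and continuous_a: "\<And>i. i \<in> I \<Longrightarrow> continuous_on U (a i)"
    and continuous_\<sigma>: "\<And>i. i \<in> I \<Longrightarrow> continuous_on U (\<sigma> i)"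
    and continuous_b: "continuous_on U b"
begin

definition L :: "('a \<Rightarrow> 'a \<Rightarrow> real) \<Rightarrow> ('a \<Rightarrow> 'a \<Rightarrow> 'a \<Rightarrow> real) \<Rightarrow> 'a \<Rightarrow> real" where
  "L u' u'' x = (\<Sum>i\<in>I. a i x * u'' x (\<sigma> i x) (\<sigma> i x)) - u' x (b x)"

lemma L_add_cmult:
  "L (\<lambda>x v. u' x v + c * w' x v) (\<lambda>x v h. u'' x v h + c * w'' x v h) x =
     L u' u'' x + c * L w' w'' x"
  by (simp add: L_def algebra_simps sum.distrib sum_distrib_left)

lemma L_nonpos_at_local_max:
  assumes u: "twice_differentiable_on u u' u'' U" and "z \<in> U"
    and max: "\<forall>\<^sub>F x in nhds z. u x \<le> u z"
  shows "L u' u'' z \<le> 0"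
proof -
  have u': "\<forall>\<^sub>F x in nhds z. (u has_derivative u' x) (at x)"
    by (rule eventually_mono[OF eventually_nhds_in_open[OF open_domain \<open>z \<in> U\<close>]])
      (use u in \<open>simp add: twice_differentiable_on_def\<close>)
  have u'': "((\<lambda>x. u' x v) has_derivative u'' z v) (at z)" for v
    using u \<open>z \<in> U\<close> by (simp add: twice_differentiable_on_def)
  have "\<forall>\<^sub>F x in at z. u x \<le> u z" using max by (simp add: eventually_nhds_conv_at)
  then have "u' z = (\<lambda>v. 0)"
    using has_derivative_local_max[OF eventually_nhds_x_imp_x[OF u']] by blast
  moreover have "u'' z v v \<le> 0" for v
    by (rule second_derivative_nonpos_at_local_max[OF u' u'' max])
  ultimately show ?thesis
    using nonneg[OF _ \<open>z \<in> U\<close>] by (simp add: L_def sum_nonpos mult_nonneg_nonpos)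
qed

lemma L_gaussian:
  "L (gaussian' \<alpha> y) (gaussian'' \<alpha> y) x = 2 * \<alpha> * gaussian \<alpha> y x *
     (2 * \<alpha> * (\<Sum>i\<in>I. a i x * (\<sigma> i x \<bullet> (x - y))\<^sup>2)
      - ((\<Sum>i\<in>I. a i x * (\<sigma> i x \<bullet> \<sigma> i x)) - (x - y) \<bullet> b x))"
proof -
  have "(\<Sum>i\<in>I. a i x * gaussian'' \<alpha> y x (\<sigma> i x) (\<sigma> i x)) = 2 * \<alpha> * gaussian \<alpha> y x *
      (\<Sum>i\<in>I. 2 * \<alpha> * (a i x * (\<sigma> i x \<bullet> (x - y))\<^sup>2) - a i x * (\<sigma> i x \<bullet> \<sigma> i x))"
    unfolding sum_distrib_left
    by (intro sum.cong refl)
      (simp add: gaussian''_def inner_commute[of "x - y"] power2_eq_square right_diff_distrib)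
  then show ?thesis
    by (simp add: L_def gaussian'_def sum_subtractf sum_distrib_left[symmetric] algebra_simps)
qed

text \<open>For large \<open>\<alpha>\<close> the part of \<open>L\<close> that is quadratic in \<open>\<alpha>\<close> dominates.\<close>

lemma gaussian_strict_subsolution:
  assumes K: "compact K" "K \<subseteq> U" "y \<notin> K"
  obtains \<alpha> where "\<alpha> > 0" "\<And>x. x \<in> K \<Longrightarrow> 0 < L (gaussian' \<alpha> y) (gaussian'' \<alpha> y) x"
proof (cases "K = {}")
  case True
  then show ?thesis using that[of 1] by simp
next
  case False
  define Q where "Q x = (\<Sum>i\<in>I. a i x * (\<sigma> i x \<bullet> (x - y))\<^sup>2)" for x
  define T where "T x = (\<Sum>i\<in>I. a i x * (\<sigma> i x \<bullet> \<sigma> i x)) - (x - y) \<bullet> b x" for x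
  have "continuous_on K Q" "continuous_on K T"
    unfolding Q_def T_def
    using continuous_a continuous_\<sigma> continuous_b \<open>K \<subseteq> U\<close>
    by (auto intro!: continuous_intros intro: continuous_on_subset)
  then obtain q t where q: "q \<in> K" "\<And>x. x \<in> K \<Longrightarrow> Q q \<le> Q x"
    and t: "\<And>x. x \<in> K \<Longrightarrow> T x \<le> T t"
    using continuous_attains_inf[OF K(1) False] continuous_attains_sup[OF K(1) False] by metis
  have "Q q > 0" unfolding Q_def using q(1) K by (intro elliptic) auto
  define \<alpha> where "\<alpha> = (\<bar>T t\<bar> + 1) / (2 * Q q)"
  show ?thesis
  proof (rule that)
    show "\<alpha> > 0" using \<open>Q q > 0\<close> by (simp add: \<alpha>_def add_nonneg_pos)
    fix x assume "x \<in> K"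
    have "T x < 2 * \<alpha> * Q q" using t[OF \<open>x \<in> K\<close>] \<open>Q q > 0\<close> by (simp add: \<alpha>_def)
    also have "\<dots> \<le> 2 * \<alpha> * Q x" using q(2)[OF \<open>x \<in> K\<close>] \<open>\<alpha> > 0\<close> by simp
    finally have "2 * \<alpha> * Q x - T x > 0" by simp
    then show "0 < L (gaussian' \<alpha> y) (gaussian'' \<alpha> y) x"
      using \<open>\<alpha> > 0\<close> unfolding L_gaussian Q_def T_def by (simp add: gaussian_def)
  qed
qed

lemma subsolution_no_touching_ball:
  assumes u: "twice_differentiable_on u u' u'' U"
    and sub: "\<And>x. x \<in> U \<Longrightarrow> 0 \<le> L u' u'' x"
    and le: "\<And>x. x \<in> U \<Longrightarrow> u x \<le> M"
    and q: "q \<in> U" "u q = M" "dist y q = d" "d > 0"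
    and less: "\<And>x. x \<in> U \<Longrightarrow> x \<in> cball y d \<Longrightarrow> x \<noteq> q \<Longrightarrow> u x < M"
  shows False
proof -
  obtain r\<^sub>0 where "r\<^sub>0 > 0" "cball q r\<^sub>0 \<subseteq> U"
    using open_domain q(1) open_contains_cball by blast
  define r where "r = min r\<^sub>0 (d / 2)"
  have r: "r > 0" "cball q r \<subseteq> U" "y \<notin> cball q r"
    using \<open>r\<^sub>0 > 0\<close> \<open>cball q r\<^sub>0 \<subseteq> U\<close> q(3,4) by (auto simp: r_def dist_commute)
  obtain \<alpha> where \<alpha>: "\<alpha> > 0" "\<And>x. x \<in> cball q r \<Longrightarrow> 0 < L (gaussian' \<alpha> y) (gaussian'' \<alpha> y) x"
    using gaussian_strict_subsolution[OF compact_cball r(2,3)] by blast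
  define w where "w x = gaussian \<alpha> y x - exp (- \<alpha> * d\<^sup>2)" for x
  have w_neg: "w x < 0 \<longleftrightarrow> d < dist y x" for x
    using gaussian_less_iff[OF \<open>\<alpha> > 0\<close>, of d y x] \<open>d > 0\<close> by (simp add: w_def)
  have w: "twice_differentiable_on w (gaussian' \<alpha> y) (gaussian'' \<alpha> y) U"
    unfolding w_def by (rule twice_differentiable_on_gaussian)
  note continuous = twice_differentiable_on_imp_continuous_on[THEN continuous_on_subset, OF _ r(2)]
  have "continuous_on (sphere q r) u" "continuous_on (sphere q r) w"
    using continuous[OF u] continuous[OF w] by (auto intro: continuous_on_subset)
  moreover have "u x \<le> M" if "x \<in> sphere q r" for x using that r(2) le by auto
  moreover have "w x < 0" if "x \<in> sphere q r" "u x = M" for x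
  proof -
    have "x \<in> U" "x \<noteq> q" using that(1) r(1,2) by auto
    then show ?thesis using less[of x] that(2) unfolding w_neg by (cases "dist y x \<le> d") auto
  qed
  ultimately obtain \<epsilon> where \<epsilon>: "\<epsilon> > 0" "\<And>x. x \<in> sphere q r \<Longrightarrow> u x + \<epsilon> * w x < M"
    using exists_perturbation_below[OF compact_sphere] by metis
  define f where "f x = u x + \<epsilon> * w x" for x
  note f = twice_differentiable_on_add_cmult[OF u w, of \<epsilon>, folded f_def]
  obtain z where z: "z \<in> cball q r" "\<And>x. x \<in> cball q r \<Longrightarrow> f x \<le> f z"
    using continuous_attains_sup[OF compact_cball _ continuous[OF f]] r(1) by force
  have "f q = M" using q(2,3) by (simp add: f_def w_def gaussian_eq_exp_dist)
  then have "z \<in> ball q r" using \<epsilon>(2)[of z] z(1) z(2)[of q] r(1) unfolding f_def by fastforce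
  then have "\<forall>\<^sub>F x in nhds z. f x \<le> f z"
    using z(2) by (auto intro!: eventually_mono[OF eventually_nhds_in_open[OF open_ball]])
  then have "L u' u'' z + \<epsilon> * L (gaussian' \<alpha> y) (gaussian'' \<alpha> y) z \<le> 0"
    using L_nonpos_at_local_max[OF f] z(1) r(2) by (auto simp: L_add_cmult)
  moreover have "0 < \<epsilon> * L (gaussian' \<alpha> y) (gaussian'' \<alpha> y) z" using \<epsilon>(1) \<alpha>(2)[OF z(1)] by simp
  ultimately show False using sub[of z] z(1) r(2) by fastforce
qed

lemma strong_maximum_principle:
  assumes u: "twice_differentiable_on u u' u'' U"
    and sub: "\<And>x. x \<in> U \<Longrightarrow> 0 \<le> L u' u'' x"
    and le: "\<And>x. x \<in> U \<Longrightarrow> u x \<le> M"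
  shows "open {x \<in> U. u x = M}"
proof (rule ccontr)
  let ?S = "{x \<in> U. u x = M}"
  assume "\<not> open ?S"
  have "closedin (top_of_set U) ?S"
    by (rule continuous_closedin_preimage_constant
        [OF twice_differentiable_on_imp_continuous_on[OF u]])
  then obtain y q where "q \<in> ?S" "y \<noteq> q" and touch: "cball y (dist y q) \<inter> ?S = {q}"
    by (rule exists_touching_ball[OF open_domain _ \<open>\<not> open ?S\<close>])
  then have q: "q \<in> U" "u q = M" "dist y q > 0" by simp_all
  have less: "u x < M" if "x \<in> U" "x \<in> cball y (dist y q)" "x \<noteq> q" for x
  proof -
    have "u x \<noteq> M" using touch that by blast
    then show ?thesis using le[OF \<open>x \<in> U\<close>] by simp
  qed
  show False by (rule subsolution_no_touching_ball[OF u sub le q(1,2) refl q(3) less])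
qed

end

section \<open>Matrices commuting with a complex structure\<close>

lemma bounded_bilinear_matrix_mult:
  "bounded_bilinear ((**) :: real^'n^'m \<Rightarrow> real^'p^'n \<Rightarrow> real^'p^'m)"
proof -
  have "linear (\<lambda>M :: real^'n^'m. M ** N)" for N :: "real^'p^'n"
    by (rule linearI)
      (simp_all add: matrix_matrix_mult_def vec_eq_iff sum.distrib distrib_right sum_distrib_left
        mult.assoc)
  moreover have "linear (\<lambda>N :: real^'p^'n. M ** N)" for M :: "real^'n^'m"
    by (rule linearI) (simp_all add: matrix_add_ldistrib matrix_scalar_ac scalar_matrix_assoc)
  ultimately show ?thesis by (simp add: bilinear_conv_bounded_bilinear[symmetric] bilinear_def)
qed

interpretation matrix_mult: bounded_bilinear "(**) :: real^'n^'m \<Rightarrow> real^'p^'n \<Rightarrow> real^'p^'m"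
  by (rule bounded_bilinear_matrix_mult)

lemma bounded_bilinear_matrix_vector_mult:
  "bounded_bilinear ((*v) :: real^'n^'m \<Rightarrow> real^'n \<Rightarrow> real^'m)"
proof -
  have "linear (\<lambda>M :: real^'n^'m. M *v w)" for w :: "real^'n"
    by (rule linearI) (simp_all add: matrix_vector_mult_add_rdistrib scaleR_matrix_vector_assoc)
  then show ?thesis by (simp add: bilinear_conv_bounded_bilinear[symmetric] bilinear_def)
qed

interpretation matrix_vector_mult: bounded_bilinear "(*v) :: real^'n^'m \<Rightarrow> real^'n \<Rightarrow> real^'m"
  by (rule bounded_bilinear_matrix_vector_mult)

lemma trace_scaleR: "trace (a *\<^sub>R M) = a * trace M" for M :: "real^'n^'n"
  by (simp add: trace_def sum_distrib_left)

lemma bounded_linear_trace: "bounded_linear (trace :: real^'n^'n \<Rightarrow> real)"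
  by (intro linear_conv_bounded_linear[THEN iffD1] linearI) (simp_all add: trace_add trace_scaleR)

lemma trace_similar:
  fixes P :: "real^'n^'n"
  assumes "P ** Q = mat 1"
  shows "trace (Q ** M ** P) = trace M"
  by (metis assms matrix_mul_assoc matrix_mul_rid trace_mul_sym)

lemma complex_combination_mem_invariant_subspace_imp_0:
  fixes J :: "'a::real_vector \<Rightarrow> 'a"
  assumes "linear J" "\<And>x. J (J x) = - x"
    and W: "subspace W" "\<And>x. x \<in> W \<Longrightarrow> J x \<in> W"
    and "v \<notin> W" "a *\<^sub>R v + b *\<^sub>R J v \<in> W"
  shows "a = 0" "b = 0"
proof -
  let ?w = "a *\<^sub>R v + b *\<^sub>R J v"
  have "a *\<^sub>R ?w - b *\<^sub>R J ?w = (a\<^sup>2 + b\<^sup>2) *\<^sub>R v"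
    by (simp add: linear_add[OF assms(1)] linear_scale[OF assms(1)] assms(2) algebra_simps
        power2_eq_square)
  moreover have "a *\<^sub>R ?w - b *\<^sub>R J ?w \<in> W"
    using W assms(6) by (intro subspace_diff subspace_scale) auto
  ultimately have "(a\<^sup>2 + b\<^sup>2) *\<^sub>R v \<in> W" by simp
  then have "a\<^sup>2 + b\<^sup>2 = 0"
    using \<open>v \<notin> W\<close> subspace_scale[OF W(1), of "(a\<^sup>2 + b\<^sup>2) *\<^sub>R v" "inverse (a\<^sup>2 + b\<^sup>2)"]
    by (cases "a\<^sup>2 + b\<^sup>2 = 0") simp_all
  then show "a = 0" "b = 0" by (simp_all add: sum_power2_eq_zero_iff)
qed

lemma complex_structure_independent_pair:
  fixes J :: "'a::euclidean_space \<Rightarrow> 'a"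
  assumes J: "linear J" "\<And>x. J (J x) = - x" and dim: "DIM('a) > 2"
  obtains u v where "\<And>a b c d. (a *\<^sub>R u + b *\<^sub>R J u) + (c *\<^sub>R v + d *\<^sub>R J v) = 0
    \<Longrightarrow> a = 0 \<and> b = 0 \<and> c = 0 \<and> d = 0"
proof -
  obtain u :: 'a where "u \<in> Basis" using nonempty_Basis by blast
  then have "u \<noteq> 0" by auto
  define W where "W = span {u, J u}"
  have "J ` W = span (J ` {u, J u})"
    unfolding W_def by (rule span_linear_image[OF J(1), symmetric])
  also have "\<dots> \<subseteq> W"
    unfolding W_def
    by (intro span_minimal subspace_span) (auto simp: J(2) intro: span_base span_neg)
  finally have W_invariant: "J x \<in> W" if "x \<in> W" for x using that by blast
  have "dim W \<le> card {u, J u}" unfolding W_def dim_span by (intro dim_le_card span_superset) simp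
  also have "\<dots> \<le> 2" by (simp add: card_insert_if)
  finally have "W \<noteq> UNIV" using dim by auto
  then obtain v where "v \<notin> W" by blast
  show ?thesis
  proof (rule that)
    fix a b c d assume zero: "(a *\<^sub>R u + b *\<^sub>R J u) + (c *\<^sub>R v + d *\<^sub>R J v) = 0"
    have "a *\<^sub>R u + b *\<^sub>R J u \<in> W"
      unfolding W_def by (intro span_add span_scale span_base) auto
    then have "c *\<^sub>R v + d *\<^sub>R J v \<in> W"
      using zero unfolding W_def by (metis add_eq_0_iff span_neg)
    then have "c = 0 \<and> d = 0"
      using complex_combination_mem_invariant_subspace_imp_0[OF J _ W_invariant \<open>v \<notin> W\<close>]
      by (auto simp: W_def)
    moreover from this have "a = 0 \<and> b = 0"
      using complex_combination_mem_invariant_subspace_imp_0[OF J, of "{0}" u a b] zero \<open>u \<noteq> 0\<close>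
      by (simp add: linear_0[OF J(1)])
    ultimately show "a = 0 \<and> b = 0 \<and> c = 0 \<and> d = 0" by simp
  qed
qed

definition standard_complex_structure :: "real^4^4" where
  "standard_complex_structure = (\<chi> i j. if (i, j) \<in> {(2, 1), (4, 3)} then 1
     else if (i, j) \<in> {(1, 2), (3, 4)} then - 1 else 0)"

lemma standard_complex_structure_mult_vector:
  "(standard_complex_structure *v z) $ 1 = - z $ 2" "(standard_complex_structure *v z) $ 2 = z $ 1"
  "(standard_complex_structure *v z) $ 3 = - z $ 4" "(standard_complex_structure *v z) $ 4 = z $ 3"
  by (simp_all add: matrix_vector_mult_def sum_4 standard_complex_structure_def)

lemma complex_structure_similar_standard:
  fixes J :: "real^4^4"
  assumes "J ** J = - mat 1"
  obtains P where "invertible P" "J ** P = P ** standard_complex_structure"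
proof -
  have JJ: "J *v (J *v w) = - w" for w
    by (simp add: matrix_vector_mul_assoc assms matrix_vector_mult.minus_left)
  obtain u v where independent:
    "\<And>a b c d. (a *\<^sub>R u + b *\<^sub>R (J *v u)) + (c *\<^sub>R v + d *\<^sub>R (J *v v)) = 0
      \<Longrightarrow> a = 0 \<and> b = 0 \<and> c = 0 \<and> d = 0"
    using complex_structure_independent_pair[OF matrix_vector_mul_linear JJ] by auto
  define P :: "real^4^4" where "P = (\<chi> i j. if j = 1 then u $ i else if j = 2 then (J *v u) $ i
     else if j = 3 then v $ i else (J *v v) $ i)"
  have P: "P *v z = (z$1 *\<^sub>R u + z$2 *\<^sub>R (J *v u)) + (z$3 *\<^sub>R v + z$4 *\<^sub>R (J *v v))" for z
    by (simp add: vec_eq_iff matrix_vector_mult_def[of P z], simp add: P_def sum_4 mult.commute)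
  have "z = 0" if "P *v z = 0" for z
    using independent[of "z$1" "z$2" "z$3" "z$4"] that unfolding P
    by (simp add: vec_eq_iff forall_4)
  then have "invertible P" by (simp add: invertible_left_inverse matrix_left_invertible_ker)
  moreover have "J *v (P *v z) = P *v (standard_complex_structure *v z)" for z
    unfolding P by (simp add: standard_complex_structure_mult_vector JJ matrix_vector_right_distrib
        matrix_vector_mult_scaleR)
  then have "J ** P = P ** standard_complex_structure"
    by (simp add: matrix_eq matrix_vector_mul_assoc)
  ultimately show ?thesis by (rule that)
qed

text \<open>This is Cayley-Hamilton for the complex \<open>2 \<times> 2\<close> matrix of \<open>C\<close>: its complex trace
  is \<open>(trace C - i trace (J C)) / 2\<close>, where \<open>J\<close> is the complex structure.\<close>

lemma square_of_traceless_commuting_with_standard: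
  fixes C :: "real^4^4"
  defines "K \<equiv> standard_complex_structure"
  assumes comm: "C ** K = K ** C" and tr: "trace C = 0" "trace (K ** C) = 0"
  obtains \<alpha> \<beta> where "C ** C = \<alpha> *\<^sub>R mat 1 + \<beta> *\<^sub>R K"
proof -
  have K: "K$1$1=0" "K$2$1=1" "K$3$1=0" "K$4$1=0" "K$1$2=-1" "K$2$2=0" "K$3$2=0" "K$4$2=0"
    "K$1$3=0" "K$2$3=0" "K$3$3=0" "K$4$3=1" "K$1$4=0" "K$2$4=0" "K$3$4=-1" "K$4$4=0"
    by (simp_all add: K_def standard_complex_structure_def)
  have entry: "(C ** K) $ i $ j = (K ** C) $ i $ j" for i j by (simp add: comm)
  have C: "C$2$2 = C$1$1" "C$1$2 = - C$2$1" "C$2$4 = C$1$3" "C$1$4 = - C$2$3"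
     "C$4$2 = C$3$1" "C$3$2 = - C$4$1" "C$4$4 = C$3$3" "C$3$4 = - C$4$3"
    using entry[of 2 1] entry[of 1 1] entry[of 2 3] entry[of 1 3]
      entry[of 4 1] entry[of 3 1] entry[of 4 3] entry[of 3 3]
    by (simp_all add: matrix_matrix_mult_def sum_4 K)
  have traceless: "C$3$3 = - C$1$1" "C$4$3 = - C$2$1"
    using tr by (simp_all add: trace_def matrix_matrix_mult_def sum_4 K C)
  let ?\<alpha> = "C$1$1 * C$1$1 - C$2$1 * C$2$1 + C$1$3 * C$3$1 - C$2$3 * C$4$1"
  let ?\<beta> = "2 * C$1$1 * C$2$1 + C$2$3 * C$3$1 + C$1$3 * C$4$1"
  have "C ** C = ?\<alpha> *\<^sub>R mat 1 + ?\<beta> *\<^sub>R K"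
    unfolding vec_eq_iff forall_4 matrix_matrix_mult_def sum_4 vec_lambda_beta
      vector_add_component vector_scaleR_component C traceless K mat_def
    by (simp add: algebra_simps)
  then show ?thesis by (rule that)
qed

lemma square_of_traceless_complex_linear:
  fixes B J :: "real^4^4"
  assumes J: "J ** J = - mat 1" and comm: "B ** J = J ** B"
    and tr: "trace B = 0" "trace (J ** B) = 0"
  obtains \<alpha> \<beta> where "B ** B = \<alpha> *\<^sub>R mat 1 + \<beta> *\<^sub>R J"
proof -
  let ?K = standard_complex_structure
  obtain P where P: "invertible P" "J ** P = P ** ?K"
    using complex_structure_similar_standard[OF J] .
  then obtain Q where Q: "P ** Q = mat 1" "Q ** P = mat 1" by (auto simp: invertible_def)
  define conj where "conj M = Q ** M ** P" for M
  have conj_mult: "conj M ** conj N = conj (M ** N)" for M N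
  proof -
    have "conj M ** conj N = Q ** M ** (P ** Q) ** N ** P"
      by (simp add: conj_def matrix_mul_assoc)
    then show ?thesis by (simp add: conj_def Q matrix_mul_assoc)
  qed
  have conj_inverse: "P ** conj M ** Q = M" for M
  proof -
    have "P ** conj M ** Q = (P ** Q) ** M ** (P ** Q)" by (simp add: conj_def matrix_mul_assoc)
    then show ?thesis by (simp add: Q)
  qed
  have conj_J: "conj J = ?K" by (metis P(2) Q(2) conj_def matrix_mul_assoc matrix_mul_lid)
  have trace_conj: "trace (conj M) = trace M" for M
    unfolding conj_def by (rule trace_similar[OF Q(1)])
  have "conj B ** ?K = ?K ** conj B" by (simp add: comm conj_mult flip: conj_J)
  moreover have "trace (conj B) = 0" "trace (?K ** conj B) = 0"
    by (simp_all add: tr conj_mult trace_conj flip: conj_J)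
  ultimately obtain \<alpha> \<beta> where square: "conj B ** conj B = \<alpha> *\<^sub>R mat 1 + \<beta> *\<^sub>R ?K"
    by (rule square_of_traceless_commuting_with_standard)
  have "B ** B = P ** (conj B ** conj B) ** Q" by (simp add: conj_mult conj_inverse)
  also have "\<dots> = \<alpha> *\<^sub>R (P ** mat 1 ** Q) + \<beta> *\<^sub>R (P ** conj J ** Q)"
    unfolding square conj_J
    by (simp only: matrix_mult.add_left matrix_mult.add_right matrix_mult.scaleR_left
        matrix_mult.scaleR_right)
  also have "\<dots> = \<alpha> *\<^sub>R mat 1 + \<beta> *\<^sub>R J" by (simp add: Q conj_inverse)
  finally show ?thesis by (rule that)
qed

lemma trace_skew_adjoint:
  fixes C G :: "real^'n^'n"
  assumes "transpose C ** G = - (G ** C)" "det G \<noteq> 0"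
  shows "trace C = 0"
proof -
  obtain H where H: "G ** H = mat 1" "H ** G = mat 1"
    using assms(2) by (auto simp: invertible_det_nz[symmetric] invertible_def)
  have "trace C = trace (transpose C)" by (simp add: trace_def transpose_def)
  also have "transpose C = (transpose C ** G) ** H" by (metis H(1) matrix_mul_assoc matrix_mul_rid)
  also have "\<dots> = - (G ** C ** H)" by (simp add: assms(1) matrix_mult.minus_left)
  also have "trace \<dots> = - trace (G ** C ** H)" by (simp add: trace_def sum_negf)
  also have "\<dots> = - trace C" by (simp add: trace_similar[OF H(2)])
  finally show ?thesis by simp
qed

section \<open>Hermitian endomorphisms\<close>

definition traceless_part :: "real^'n^'n \<Rightarrow> real^'n^'n" where
  "traceless_part M = M - (trace M / real CARD('n)) *\<^sub>R mat 1"

text \<open>If the eigenvalues of \<open>M\<close> are \<open>\<rho>\<close> and \<open>cnj \<rho>\<close> with equal multiplicities, this is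
  \<open>(Im \<rho>)\<^sup>2\<close>; if they are real, it is \<open>\<le> 0\<close>.\<close>

definition im_square :: "real^'n^'n \<Rightarrow> real" where
  "im_square M = - trace (traceless_part M ** traceless_part M) / real CARD('n)"

lemma trace_traceless_part: "trace (traceless_part M) = 0"
  by (simp add: traceless_part_def trace_sub trace_scaleR trace_I)

lemma bounded_linear_traceless_part:
  "bounded_linear (traceless_part :: real^'n^'n \<Rightarrow> real^'n^'n)"
  by (intro linear_conv_bounded_linear[THEN iffD1] linearI)
    (simp_all add: traceless_part_def trace_add trace_scaleR algebra_simps add_divide_distrib)

lemma traceless_part_mult: "traceless_part M ** N = M ** N - (trace M / real CARD('n)) *\<^sub>R N"
  for M N :: "real^'n^'n"
  by (simp add: traceless_part_def matrix_mult.diff_left matrix_mult.scaleR_left)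

lemma mult_traceless_part: "N ** traceless_part M = N ** M - (trace M / real CARD('n)) *\<^sub>R N"
  for M N :: "real^'n^'n"
  by (simp add: traceless_part_def matrix_mult.diff_right matrix_mult.scaleR_right)

lemma transpose_traceless_part: "transpose (traceless_part M) = traceless_part (transpose M)"
  by (simp add: traceless_part_def transpose_def vec_eq_iff mat_def trace_def)

lemma trace_traceless_part_mult_traceless_part:
  "trace (traceless_part M ** traceless_part N) = trace (traceless_part M ** N)"
  by (simp add: mult_traceless_part trace_sub trace_scaleR trace_traceless_part)

lemma im_square_similar:
  assumes "M' ** P = P ** M" "det P \<noteq> 0"
  shows "im_square M' = im_square M"
proof -
  obtain Q where Q: "P ** Q = mat 1" "Q ** P = mat 1"
    using assms(2) by (auto simp: invertible_det_nz[symmetric] invertible_def)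
  have trace_eq: "trace N' = trace N" if "N' ** P = P ** N" for N N'
  proof -
    have "Q ** N' ** P = N" by (metis that Q(2) matrix_mul_assoc matrix_mul_lid)
    then show ?thesis using trace_similar[OF Q(1), of N'] by simp
  qed
  have "traceless_part M' ** P = P ** traceless_part M"
    by (simp add: traceless_part_mult mult_traceless_part assms(1) trace_eq[OF assms(1)])
  then have "(traceless_part M' ** traceless_part M') ** P =
      P ** (traceless_part M ** traceless_part M)"
    by (metis matrix_mul_assoc)
  from trace_eq[OF this] show ?thesis by (simp add: im_square_def)
qed

lemma trace_mult_outer: "trace (M ** outer u v) = v \<bullet> (M *v u)"
  by (simp add: trace_def outer_def matrix_matrix_mult_def matrix_vector_mult_def inner_vec_def
      sum_distrib_left mult_ac)

lemma inner_matrix_vector_mult: "v \<bullet> (M *v u) = (transpose M *v v) \<bullet> u" for M :: "real^'n^'m"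
  by (simp add: dot_lmul_matrix)

lemma complex_eigenvalue_iff_map_matrix:
  "complex_eigenvalue M \<rho> \<longleftrightarrow> (\<exists>v. v \<noteq> 0 \<and> map_matrix complex_of_real M *v v = \<rho> *s v)"
  by (simp add: complex_eigenvalue_def matrix_vector_mult_def)

lemma complex_eigenvalue_diff_scalar:
  assumes "complex_eigenvalue M \<rho>"
  shows "complex_eigenvalue (M - t *\<^sub>R mat 1) (\<rho> - of_real t)"
proof -
  have "map_matrix complex_of_real (M - t *\<^sub>R mat 1) =
      map_matrix complex_of_real M - mat (of_real t)"
    by (simp add: vec_eq_iff mat_def)
  moreover have "mat (of_real t) *v v = of_real t *s v" for v :: "complex^4"
    by (simp add: vec_eq_iff matrix_vector_mult_def mat_def if_distrib[of "\<lambda>a. a * _"]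
        cong: if_cong)
  ultimately show ?thesis
    using assms unfolding complex_eigenvalue_iff_map_matrix
    by (auto simp: matrix_vector_mult_diff_rdistrib vec.scale_left_diff_distrib)
qed

lemma complex_eigenvalue_square:
  assumes "complex_eigenvalue M \<rho>"
  shows "complex_eigenvalue (M ** M) (\<rho> * \<rho>)"
proof -
  let ?C = "map_matrix complex_of_real"
  have "?C (M ** M) *v v = ?C M *v (?C M *v v)" for v
    by (simp add: matrix_vector_mul_assoc)
      (simp add: vec_eq_iff matrix_matrix_mult_def map_matrix_def)
  moreover have "?C M *v (\<rho> *s v) = \<rho> *s (?C M *v v)" for v
    by (rule vec.scale)
  ultimately show ?thesis
    using assms unfolding complex_eigenvalue_iff_map_matrix by (metis vec.scale_scale)
qed

lemma complex_eigenvalue_scalar: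
  assumes "complex_eigenvalue (t *\<^sub>R mat 1) \<rho>"
  shows "\<rho> = of_real t"
proof -
  obtain v :: "complex^4" and i where v: "v $ i \<noteq> 0"
    "(\<chi> i. \<Sum>j\<in>UNIV. complex_of_real ((t *\<^sub>R mat 1 :: real^4^4) $ i $ j) * v $ j) = \<rho> *s v"
    using assms unfolding complex_eigenvalue_def by (auto simp: vec_eq_iff)
  have "complex_of_real t * v $ i = \<rho> * v $ i"
    using fun_cong[OF arg_cong[OF v(2), of vec_nth], of i]
    by (simp add: mat_def if_distrib if_distribR cong: if_cong)
  then show ?thesis using v(1) by simp
qed

locale hermitian_endomorphism =
  fixes G J A :: "real^4^4"
  assumes G_nondegenerate: "det G \<noteq> 0"
    and G_symmetric: "transpose G = G"
    and J_square: "J ** J = - mat 1"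
    and J_skew_adjoint: "transpose J ** G = - (G ** J)"
    and A_self_adjoint: "G ** A = transpose A ** G"
    and A_commutes_J: "A ** J = J ** A"
begin

abbreviation B :: "real^4^4" where
  "B \<equiv> traceless_part A"

lemma B_self_adjoint: "transpose B ** G = G ** B"
  by (simp add: transpose_traceless_part traceless_part_mult mult_traceless_part A_self_adjoint)
    (simp add: trace_def transpose_def)

lemma B_commutes_J: "B ** J = J ** B"
  by (simp add: traceless_part_mult mult_traceless_part A_commutes_J)

lemma trace_J_mult_hermitian:
  assumes "transpose C ** G = G ** C" "C ** J = J ** C"
  shows "trace (J ** C) = 0"
proof (rule trace_skew_adjoint[OF _ G_nondegenerate])
  have "transpose (J ** C) ** G = transpose C ** (transpose J ** G)"
    by (simp add: matrix_transpose_mul matrix_mul_assoc)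
  also have "\<dots> = - (transpose C ** G ** J)"
    by (simp add: J_skew_adjoint matrix_mult.minus_right matrix_mul_assoc)
  also have "\<dots> = - (G ** (J ** C))" by (simp add: assms flip: matrix_mul_assoc)
  finally show "transpose (J ** C) ** G = - (G ** (J ** C))" .
qed

lemma B_square: "B ** B = (- im_square A) *\<^sub>R mat 1"
proof -
  obtain \<alpha> \<beta> where square: "B ** B = \<alpha> *\<^sub>R mat 1 + \<beta> *\<^sub>R J"
    using square_of_traceless_complex_linear[OF J_square B_commutes_J trace_traceless_part
        trace_J_mult_hermitian[OF B_self_adjoint B_commutes_J]] .
  have "trace (J ** (B ** B)) = 0"
  proof (rule trace_J_mult_hermitian)
    show "transpose (B ** B) ** G = G ** (B ** B)"
      by (metis B_self_adjoint matrix_mul_assoc matrix_transpose_mul)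
    show "B ** B ** J = J ** (B ** B)" by (metis B_commutes_J matrix_mul_assoc)
  qed
  moreover have "J ** (B ** B) = \<alpha> *\<^sub>R J - \<beta> *\<^sub>R mat 1"
    by (simp add: square matrix_mult.add_right matrix_mult.scaleR_right J_square)
  moreover have "trace J = 0" using trace_J_mult_hermitian[of "mat 1"] by simp
  ultimately have "\<beta> = 0" by (simp add: trace_sub trace_scaleR trace_I)
  with square have "B ** B = \<alpha> *\<^sub>R mat 1" by simp
  moreover from this have "im_square A = - \<alpha>" by (simp add: im_square_def trace_scaleR trace_I)
  ultimately show ?thesis by simp
qed

lemma im_square_pos:
  assumes "complex_eigenvalue A \<rho>" "Im \<rho> \<noteq> 0"
  shows "im_square A > 0"
proof -
  define \<mu> where "\<mu> = \<rho> - of_real (trace A / 4)"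
  have "complex_eigenvalue (B ** B) (\<mu> * \<mu>)"
    using complex_eigenvalue_square
      [OF complex_eigenvalue_diff_scalar[OF assms(1), of "trace A / 4"]]
    unfolding traceless_part_def \<mu>_def by simp
  then have "\<mu> * \<mu> = of_real (- im_square A)"
    unfolding B_square by (rule complex_eigenvalue_scalar)
  then have "Re (\<mu> * \<mu>) = - im_square A" "Im (\<mu> * \<mu>) = 0" by simp_all
  moreover have "Im \<mu> \<noteq> 0" using assms(2) by (simp add: \<mu>_def)
  ultimately have "Re \<mu> = 0" "im_square A = (Im \<mu>)\<^sup>2" by (auto simp: power2_eq_square)
  with \<open>Im \<mu> \<noteq> 0\<close> show ?thesis by simp
qed

lemma trace_B_mult_symmetrized_outer:
  "trace (B ** (outer \<Lambda> (G *v X) + outer X (G *v \<Lambda>)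
      + outer (J *v \<Lambda>) (G *v (J *v X)) + outer (J *v X) (G *v (J *v \<Lambda>)))) =
    4 * ((G *v \<Lambda>) \<bullet> (B *v X))"
proof -
  have symmetric: "(G *v u) \<bullet> (B *v w) = (G *v w) \<bullet> (B *v u)" for u w
  proof -
    have "(G *v u) \<bullet> (B *v w) = (transpose B *v (G *v u)) \<bullet> w"
      by (rule inner_matrix_vector_mult)
    also have "\<dots> = w \<bullet> (G *v (B *v u))"
      by (simp add: matrix_vector_mul_assoc B_self_adjoint inner_commute)
    also have "\<dots> = (G *v w) \<bullet> (B *v u)"
      by (simp add: inner_matrix_vector_mult G_symmetric del: transpose_matrix_vector)
    finally show ?thesis .
  qed
  have J_isometry: "transpose J ** G ** J = G"
    by (simp add: J_skew_adjoint matrix_mult.minus_left matrix_mult.minus_right J_square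
        flip: matrix_mul_assoc)
  have J_invariant: "(G *v (J *v u)) \<bullet> (B *v (J *v w)) = (G *v u) \<bullet> (B *v w)" for u w
  proof -
    have "(G *v (J *v u)) \<bullet> (B *v (J *v w)) = (G *v (J *v u)) \<bullet> (J *v (B *v w))"
      by (simp add: matrix_vector_mul_assoc B_commutes_J)
    also have "\<dots> = (transpose J *v (G *v (J *v u))) \<bullet> (B *v w)"
      by (rule inner_matrix_vector_mult)
    also have "transpose J *v (G *v (J *v u)) = G *v u"
      by (simp only: matrix_vector_mul_assoc matrix_mul_assoc J_isometry)
    finally show ?thesis .
  qed
  show ?thesis
    by (simp add: matrix_mult.add_right trace_add trace_mult_outer J_invariant symmetric[of X \<Lambda>])
qed

end

section \<open>Cauchy-Riemann equations\<close>

lemma continuous_on_apply_linear: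
  fixes F :: "'a::topological_space \<Rightarrow> 'b::euclidean_space \<Rightarrow> 'c::real_normed_vector"
  assumes linear: "\<And>x. x \<in> U \<Longrightarrow> linear (F x)"
    and F: "\<And>v. continuous_on U (\<lambda>x. F x v)" and g: "continuous_on U g"
  shows "continuous_on U (\<lambda>x. F x (g x))"
proof -
  have "(\<Sum>k\<in>Basis. (g x \<bullet> k) *\<^sub>R F x k) = F x (g x)" if "x \<in> U" for x
  proof -
    have "F x (\<Sum>k\<in>Basis. (g x \<bullet> k) *\<^sub>R k) = (\<Sum>k\<in>Basis. (g x \<bullet> k) *\<^sub>R F x k)"
      by (simp add: linear_sum[OF linear[OF that]] linear_scale[OF linear[OF that]])
    then show ?thesis by (simp add: euclidean_representation)
  qed
  moreover have "continuous_on U (\<lambda>x. \<Sum>k\<in>Basis. (g x \<bullet> k) *\<^sub>R F x k)"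
    by (intro continuous_intros F g)
  ultimately show ?thesis by (rule continuous_on_eq[rotated])
qed

text \<open>The assumption on the derivative of \<open>E\<close> says that \<open>R + i \<surd>E\<close> is holomorphic for the
  almost complex structure \<open>B / \<surd>E\<close>, where \<open>E > 0\<close>.\<close>

locale cauchy_riemann =
  fixes U :: "(real^'n) set" and R E :: "real^'n \<Rightarrow> real" and B :: "real^'n \<Rightarrow> real^'n^'n"
  assumes open_domain: "open U"
    and smooth_R: "smooth_on U R"
    and smooth_B: "smooth_on U B"
    and derivative_E: "\<And>x. x \<in> U \<Longrightarrow>
      (E has_derivative (\<lambda>v. - 2 * (gradient R x \<bullet> (B x *v v)))) (at x)"
    and B_square: "\<And>x v. x \<in> U \<Longrightarrow> B x *v (B x *v v) = - E x *\<^sub>R v"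
begin

definition E' :: "real^'n \<Rightarrow> real^'n \<Rightarrow> real" where
  "E' x v = - 2 * (gradient R x \<bullet> (B x *v v))"

abbreviation hessian_R :: "real^'n \<Rightarrow> real^'n \<Rightarrow> real^'n" where
  "hessian_R x \<equiv> frechet_derivative (gradient R) (at x)"

abbreviation B' :: "real^'n \<Rightarrow> real^'n \<Rightarrow> real^'n^'n" where
  "B' x \<equiv> frechet_derivative B (at x)"

definition E'' :: "real^'n \<Rightarrow> real^'n \<Rightarrow> real^'n \<Rightarrow> real" where
  "E'' x v h = - 2 * (gradient R x \<bullet> (B' x h *v v) + hessian_R x h \<bullet> (B x *v v))"

lemma twice_differentiable_on_E: "twice_differentiable_on E E' E'' U"
  unfolding twice_differentiable_on_def
proof (intro ballI conjI allI)
  fix x v assume x: "x \<in> U"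
  show "(E has_derivative E' x) (at x)"
    unfolding E'_def by (rule derivative_E[OF x])
  have "((\<lambda>y. B y *v v) has_derivative (\<lambda>h. B' x h *v v)) (at x)"
    by (rule bounded_linear.has_derivative[OF matrix_vector_mult.bounded_linear_left
          smooth_on_has_derivative[OF smooth_B open_domain x]])
  from has_derivative_inner[OF smooth_on_gradient_has_derivative[OF smooth_R open_domain x] this]
  show "((\<lambda>y. E' y v) has_derivative E'' x v) (at x)"
    unfolding E'_def E''_def by (rule has_derivative_mult_right)
qed

lemma E'_B: "x \<in> U \<Longrightarrow> E' x (B x *v v) = 2 * E x * (gradient R x \<bullet> v)"
  by (simp add: E'_def B_square)

lemma linear_E': "x \<in> U \<Longrightarrow> linear (E' x)"
  using has_derivative_linear[OF derivative_E] by (simp add: E'_def[abs_def])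

definition drift :: "real^'n \<Rightarrow> real^'n \<Rightarrow> real^'n" where
  "drift x v = - (B x *v (B' x v *v v))
     - (1 / E x) *\<^sub>R (B x *v (B' x (B x *v v) *v (B x *v v)))"

text \<open>The Hessian of \<open>R\<close> drops out because it is symmetric.\<close>

lemma elliptic_equation:
  assumes x: "x \<in> U" and "E x \<noteq> 0"
  shows "E x * E'' x v v + E'' x (B x *v v) (B x *v v) = E' x (drift x v)"
proof -
  let ?r = "gradient R x"
  let ?w\<^sub>1 = "B' x v *v v" and ?w\<^sub>2 = "B' x (B x *v v) *v (B x *v v)"
  have "hessian_R x (B x *v v) \<bullet> v = hessian_R x v \<bullet> (B x *v v)"
    by (rule derivative_of_gradient_symmetric[OF smooth_R open_domain x])
  then have "E x * E'' x v v + E'' x (B x *v v) (B x *v v) =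
      - 2 * E x * (?r \<bullet> ?w\<^sub>1) - 2 * (?r \<bullet> ?w\<^sub>2)"
    by (simp add: E''_def B_square[OF x] algebra_simps)
  also have "\<dots> = - E' x (B x *v ?w\<^sub>1) - (1 / E x) * E' x (B x *v ?w\<^sub>2)"
    using \<open>E x \<noteq> 0\<close> by (simp add: E'_B[OF x])
  also have "\<dots> = E' x (drift x v)"
    by (simp add: drift_def linear_diff[OF linear_E'[OF x]] linear_neg[OF linear_E'[OF x]]
        linear_scale[OF linear_E'[OF x]])
  finally show ?thesis .
qed

lemma continuous_on_E: "continuous_on U E"
  using twice_differentiable_on_E by (rule twice_differentiable_on_imp_continuous_on)

lemma continuous_on_B_mult: "continuous_on U (\<lambda>x. B x *v v)"
  by (rule matrix_vector_mult.continuous_on[OF smooth_on_imp_continuous_on[OF smooth_B]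
        continuous_on_const])

lemma continuous_on_drift: "continuous_on {x \<in> U. E x \<noteq> 0} (\<lambda>x. drift x v)"
proof -
  note B = smooth_on_imp_continuous_on[OF smooth_B]
  have B': "continuous_on U (\<lambda>x. B' x h)" for h
    by (rule smooth_on_imp_continuous_on[OF smooth_on_frechet_derivative[OF smooth_B]])
  have B'_B: "continuous_on U (\<lambda>x. B' x (B x *v v))"
    by (rule continuous_on_apply_linear[OF _ B' continuous_on_B_mult])
      (rule has_derivative_linear[OF smooth_on_has_derivative[OF smooth_B open_domain]])
  note mult = matrix_vector_mult.continuous_on
  note continuous = continuous_on_E mult[OF B mult[OF B' continuous_on_const]]
    mult[OF B mult[OF B'_B continuous_on_B_mult]]
  have "{x \<in> U. E x \<noteq> 0} \<subseteq> U" by blast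
  note continuous[THEN continuous_on_subset, OF this]
  then show ?thesis
    unfolding drift_def by (intro continuous_intros) auto
qed

sublocale elliptic: elliptic_operator "{x \<in> U. E x > 0}" "Basis <+> Basis"
  "case_sum (\<lambda>k. E) (\<lambda>k x. 1)" "case_sum (\<lambda>k x. k) (\<lambda>k x. B x *v k)"
  "\<lambda>x. \<Sum>k\<in>Basis. drift x k"
proof
  let ?V = "{x \<in> U. E x > 0}"
  let ?a = "case_sum (\<lambda>k. E) (\<lambda>k x. 1)" and ?\<sigma> = "case_sum (\<lambda>k x. k) (\<lambda>k x. B x *v k)"
  have VU: "?V \<subseteq> U" by blast
  show "open ?V"
    using continuous_open_preimage[OF continuous_on_E open_domain open_greaterThan, of 0]
    by (simp add: vimage_def Int_def)
  show "continuous_on ?V (\<lambda>x. \<Sum>k\<in>Basis. drift x k)"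
    by (intro continuous_on_sum continuous_on_subset[OF continuous_on_drift]) auto
  show "0 < (\<Sum>i\<in>Basis <+> Basis. ?a i x * (?\<sigma> i x \<bullet> \<xi>)\<^sup>2)" if "x \<in> ?V" "\<xi> \<noteq> 0" for x \<xi>
  proof -
    have "(\<Sum>k\<in>Basis. (k \<bullet> \<xi>)\<^sup>2) = \<xi> \<bullet> \<xi>"
      by (simp add: euclidean_inner[of \<xi> \<xi>] inner_commute power2_eq_square)
    then have "0 < E x * (\<Sum>k\<in>Basis. (k \<bullet> \<xi>)\<^sup>2)" using that by simp
    then show ?thesis
      by (simp add: sum.Plus sum_distrib_left add_pos_nonneg sum_nonneg)
  qed
  show "0 \<le> ?a i x" if "x \<in> ?V" for i x using that by (simp split: sum.split)
  show "continuous_on ?V (?a i)" for i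
    using continuous_on_subset[OF continuous_on_E VU] by (simp split: sum.split)
  show "continuous_on ?V (?\<sigma> i)" for i
    using continuous_on_subset[OF continuous_on_B_mult VU] by (simp split: sum.split)
qed

lemma open_level_set_of_positive_maximum:
  assumes "M > 0" and le: "\<And>x. x \<in> U \<Longrightarrow> E x \<le> M"
  shows "open {x \<in> U. E x = M}"
proof -
  have "open {x \<in> {x \<in> U. E x > 0}. E x = M}"
  proof (rule elliptic.strong_maximum_principle)
    show "twice_differentiable_on E E' E'' {x \<in> U. E x > 0}"
      using twice_differentiable_on_E by (simp add: twice_differentiable_on_def)
    show "0 \<le> elliptic.L E' E'' x" if "x \<in> {x \<in> U. E x > 0}" for x
      using that elliptic_equation[of x]
      by (simp add: elliptic.L_def sum.Plus linear_sum[OF linear_E'] flip: sum.distrib)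
  qed (use le in simp)
  also have "{x \<in> {x \<in> U. E x > 0}. E x = M} = {x \<in> U. E x = M}" using \<open>M > 0\<close> by auto
  finally show ?thesis .
qed

lemma gradient_R_eq_0_if_E_constant:
  assumes "x \<in> U" "M \<noteq> 0" and const: "\<And>y. y \<in> U \<Longrightarrow> E y = M"
  shows "gradient R x = 0"
proof -
  have "(E has_derivative (\<lambda>h. 0)) (at x)"
    by (rule has_derivative_transform_within_open[OF has_derivative_const open_domain \<open>x \<in> U\<close>])
      (simp add: const)
  then have "E' x = (\<lambda>h. 0)"
    using derivative_E[OF \<open>x \<in> U\<close>] unfolding E'_def[abs_def]
    by (rule has_derivative_unique[symmetric])
  then have "E x * (gradient R x \<bullet> gradient R x) = 0"
    using E'_B[OF \<open>x \<in> U\<close>, of "gradient R x"] by simp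
  then show ?thesis using \<open>M \<noteq> 0\<close> const[OF \<open>x \<in> U\<close>] by simp
qed

end

section \<open>Solutions in a coordinate chart\<close>

lemma has_derivative_im_square:
  fixes A :: "'a::real_normed_vector \<Rightarrow> real^'n^'n"
  assumes "(A has_derivative A') (at x)"
  shows "((\<lambda>y. im_square (A y)) has_derivative
    (\<lambda>h. - 2 / real CARD('n) * trace (traceless_part (A x) ** A' h))) (at x)"
proof -
  have B: "((\<lambda>y. traceless_part (A y)) has_derivative (\<lambda>h. traceless_part (A' h))) (at x)"
    by (rule bounded_linear.has_derivative[OF bounded_linear_traceless_part assms])
  from bounded_linear.has_derivative[OF bounded_linear_trace matrix_mult.FDERIV[OF B B]]
  have "((\<lambda>y. - 1 / real CARD('n) * trace (traceless_part (A y) ** traceless_part (A y)))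
      has_derivative (\<lambda>h. - 1 / real CARD('n) * trace (
        traceless_part (A x) ** traceless_part (A' h) +
        traceless_part (A' h) ** traceless_part (A x)))) (at x)"
    by (rule has_derivative_mult_right)
  moreover have "trace (traceless_part (A x) ** traceless_part (A' h) +
      traceless_part (A' h) ** traceless_part (A x)) =
      2 * trace (traceless_part (A x) ** A' h)" for h
    unfolding trace_add trace_mul_sym[of "traceless_part (A' h)"]
    by (simp add: trace_traceless_part_mult_traceless_part)
  ultimately show ?thesis by (simp add: im_square_def mult.assoc[symmetric])
qed

locale local_solution =
  fixes U :: "(real^4) set" and G J A :: "real^4 \<Rightarrow> real^4^4"
  assumes open_domain: "open U"
    and smooth_A: "smooth_on U A"
    and hermitian: "\<And>x. x \<in> U \<Longrightarrow> hermitian_endomorphism (G x) (J x) (A x)"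
    and covariant_derivative_A: "\<And>x i. x \<in> U \<Longrightarrow> covd G A x i =
        outer (Lam G A x) (G x *v axis i 1) + outer (axis i 1) (G x *v Lam G A x)
        + outer (J x *v Lam G A x) (G x *v (J x *v axis i 1))
        + outer (J x *v axis i 1) (G x *v (J x *v Lam G A x))"
begin

definition R :: "real^4 \<Rightarrow> real" where
  "R x = trace (A x) / 4"

abbreviation B :: "real^4 \<Rightarrow> real^4^4" where
  "B x \<equiv> traceless_part (A x)"

lemma smooth_R: "smooth_on U R"
  unfolding R_def[abs_def] divide_inverse
  using smooth_on_bounded_linear[OF open_domain _ smooth_A]
    bounded_linear_compose[OF bounded_linear_mult_left bounded_linear_trace] by blast

lemma gradient_R:
  assumes x: "x \<in> U"
  shows "gradient R x = G x *v Lam G A x"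
proof -
  interpret at_x: hermitian_endomorphism "G x" "J x" "A x" by (rule hermitian[OF x])
  have "invertible (G x)" using at_x.G_nondegenerate by (simp add: invertible_det_nz)
  then have "G x ** matrix_inv (G x) = mat 1"
    unfolding matrix_inv_def invertible_def by (rule someI2_ex) simp
  then have Lam: "G x *v Lam G A x = (1/4) *\<^sub>R (\<chi> b. pd (\<lambda>y. trace (A y)) x b)"
    by (simp add: Lam_def matrix_vector_mult_scaleR matrix_vector_mul_assoc)
  have "((\<lambda>y. 4 * R y) has_derivative (\<lambda>v. 4 * (gradient R x \<bullet> v))) (at x)"
    by (rule has_derivative_mult_right[OF
          smooth_on_has_derivative_inner_gradient[OF smooth_R open_domain x]])
  then have "pd (\<lambda>y. trace (A y)) x i = 4 * gradient R x $ i" for i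
    unfolding pd_def by (simp add: R_def inner_axis flip: frechet_derivative_at)
  then show ?thesis by (simp add: Lam vec_eq_iff)
qed

text \<open>The Christoffel terms of \<open>covd\<close> are commutators with \<open>A\<close>, so \<open>tr (B \<nabla>\<^sub>i A) = tr (B \<partial>\<^sub>i A)\<close>.\<close>

lemma trace_B_mult_pd:
  assumes x: "x \<in> U"
  shows "trace (B x ** pd A x i) = 4 * (gradient R x \<bullet> (B x *v axis i 1))"
proof -
  interpret at_x: hermitian_endomorphism "G x" "J x" "A x" by (rule hermitian[OF x])
  let ?\<Gamma> = "christ G x i"
  have "trace (B x ** (?\<Gamma> ** A x)) = trace ((?\<Gamma> ** A x) ** B x)" by (rule trace_mul_sym)
  also have "\<dots> = trace (?\<Gamma> ** (A x ** B x))" by (simp only: matrix_mul_assoc)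
  also have "\<dots> = trace ((A x ** B x) ** ?\<Gamma>)" by (rule trace_mul_sym)
  also have "A x ** B x = B x ** A x" by (simp add: traceless_part_mult mult_traceless_part)
  finally have commutator: "trace (B x ** (?\<Gamma> ** A x)) = trace (B x ** (A x ** ?\<Gamma>))"
    by (simp only: matrix_mul_assoc)
  have "trace (B x ** pd A x i) = trace (B x ** covd G A x i)"
    by (simp add: covd_def matrix_mult.add_right matrix_mult.diff_right trace_add trace_sub
        commutator)
  also have "\<dots> = 4 * ((G x *v Lam G A x) \<bullet> (B x *v axis i 1))"
    by (simp only: covariant_derivative_A[OF x] at_x.trace_B_mult_symmetrized_outer)
  finally show ?thesis by (simp add: gradient_R[OF x])
qed

lemma has_derivative_im_square_A:
  assumes x: "x \<in> U"
  shows "((\<lambda>y. im_square (A y)) has_derivative (\<lambda>v. - 2 * (gradient R x \<bullet> (B x *v v)))) (at x)"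
proof -
  have derivative: "((\<lambda>y. im_square (A y)) has_derivative
      (\<lambda>v. - 2 / real CARD(4) * trace (B x ** frechet_derivative A (at x) v))) (at x)"
    by (rule has_derivative_im_square[OF smooth_on_has_derivative[OF smooth_A open_domain x]])
  have linear: "linear (\<lambda>v. - 2 * (gradient R x \<bullet> (B x *v v)))"
    by (rule linearI)
      (simp_all add: matrix_vector_right_distrib matrix_vector_mult_scaleR inner_add_right)
  have "(\<lambda>v. - 2 / real CARD(4) * trace (B x ** frechet_derivative A (at x) v)) =
      (\<lambda>v. - 2 * (gradient R x \<bullet> (B x *v v)))"
  proof (rule linear_eq_stdbasis[OF has_derivative_linear[OF derivative] linear])
    fix b :: "real^4" assume "b \<in> Basis"
    then obtain i where "b = axis i 1" by (auto simp: Basis_vec_def)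
    then show "- 2 / real CARD(4) * trace (B x ** frechet_derivative A (at x) b) =
        - 2 * (gradient R x \<bullet> (B x *v b))"
      using trace_B_mult_pd[OF x, of i] by (simp add: pd_def)
  qed
  with derivative show ?thesis by simp
qed

sublocale cauchy_riemann U R "\<lambda>x. im_square (A x)" B
proof
  fix x v assume x: "x \<in> U"
  interpret at_x: hermitian_endomorphism "G x" "J x" "A x" by (rule hermitian[OF x])
  show "B x *v (B x *v v) = - im_square (A x) *\<^sub>R v"
    by (simp add: matrix_vector_mul_assoc at_x.B_square scaleR_matrix_vector_assoc[symmetric]
        matrix_vector_mult.minus_left)
qed (use open_domain smooth_R has_derivative_im_square_A
    smooth_on_bounded_linear[OF open_domain bounded_linear_traceless_part smooth_A] in auto)

lemma parallel_if_im_square_constant: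
  assumes x: "x \<in> U" and "M \<noteq> 0" "\<And>y. y \<in> U \<Longrightarrow> im_square (A y) = M"
  shows "covd G A x i = 0"
proof -
  interpret at_x: hermitian_endomorphism "G x" "J x" "A x" by (rule hermitian[OF x])
  have "G x *v Lam G A x = 0"
    using gradient_R_eq_0_if_E_constant[OF assms] gradient_R[OF x] by simp
  then have "Lam G A x = 0"
    using at_x.G_nondegenerate
    by (metis invertible_det_nz invertible_left_inverse matrix_left_invertible_ker)
  then show ?thesis
    by (simp add: covariant_derivative_A[OF x]) (simp add: outer_def vec_eq_iff)
qed

end

lemma local_solution_chart:
  assumes "smooth_atlas X At" "kaehler_surface X At G J" "in_AgJ At G J A" "c \<in> At"
  shows "local_solution (cdom c) (G c) (J c) (A c)"
proof
  show "open (cdom c)" using assms(1,4) by (auto simp: smooth_atlas_def is_chart_def cdom_def)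
  show "smooth_on (cdom c) (A c)" using assms(3,4) by (auto simp: in_AgJ_def smooth_11_field_def)
next
  fix x assume x: "x \<in> cdom c"
  show "det (G c x) \<noteq> 0" "transpose (G c x) = G c x"
    "J c x ** J c x = - mat 1" "transpose (J c x) ** G c x = - (G c x ** J c x)"
    using assms(2,4) x by (auto simp: kaehler_surface_def pseudo_metric_def)
  show "G c x ** A c x = transpose (A c x) ** G c x" "A c x ** J c x = J c x ** A c x"
    using assms(3,4) x by (auto simp: in_AgJ_def)
  show "covd (G c) (A c) x i =
        outer (Lam (G c) (A c) x) (G c x *v axis i 1)
        + outer (axis i 1) (G c x *v Lam (G c) (A c) x)
        + outer (J c x *v Lam (G c) (A c) x) (G c x *v (J c x *v axis i 1))
        + outer (J c x *v axis i 1) (G c x *v (J c x *v Lam (G c) (A c) x))" for i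
    using assms(3,4) x by (simp add: in_AgJ_def Let_def)
qed

section \<open>Functions on a manifold\<close>

lemma chart_inj_on: "is_chart X c \<Longrightarrow> inj_on (snd c) (fst c)"
  unfolding is_chart_def
  by (metis homeomorphic_imp_injective_map openin_subset topspace_subtopology_subset)

lemma chart_continuous_map:
  "is_chart X c \<Longrightarrow> continuous_map (subtopology X (fst c)) (top_of_set (cdom c)) (snd c)"
  unfolding is_chart_def cdom_def by (simp add: homeomorphic_imp_continuous_map)

lemma openin_chart_preimage:
  assumes "is_chart X c" "open S" "S \<subseteq> cdom c"
  shows "openin X {p \<in> fst c. snd c p \<in> S}"
proof -
  have c: "openin X (fst c)" using assms(1) by (simp add: is_chart_def)
  have "open (cdom c)" using assms(1) by (simp add: is_chart_def cdom_def)
  then have "openin (top_of_set (cdom c)) S" using assms(2,3) by (simp add: openin_open_eq)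
  then have "openin (subtopology X (fst c)) {p \<in> topspace (subtopology X (fst c)). snd c p \<in> S}"
    by (rule openin_continuous_map_preimage[OF chart_continuous_map[OF assms(1)]])
  moreover have "{p \<in> topspace (subtopology X (fst c)). snd c p \<in> S} = {p \<in> fst c. snd c p \<in> S}"
    using openin_subset[OF c] by auto
  ultimately show ?thesis using openin_trans_full[OF _ c] by simp
qed

lemma glue_chart_functions:
  fixes f :: "'m chart \<Rightarrow> real^4 \<Rightarrow> 'b::topological_space"
  assumes atlas: "smooth_atlas X At"
    and cont: "\<And>c. c \<in> At \<Longrightarrow> continuous_on (cdom c) (f c)"
    and compatible: "\<And>c d p. c \<in> At \<Longrightarrow> d \<in> At \<Longrightarrow> p \<in> fst c \<Longrightarrow> p \<in> fst d
      \<Longrightarrow> f c (snd c p) = f d (snd d p)"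
  obtains F where "continuous_map X euclidean F"
    "\<And>c p. c \<in> At \<Longrightarrow> p \<in> fst c \<Longrightarrow> F p = f c (snd c p)"
proof -
  have chart: "is_chart X c" if "c \<in> At" for c using atlas that by (simp add: smooth_atlas_def)
  have cover: "(\<Union>c\<in>At. fst c) = topspace X" using atlas by (simp add: smooth_atlas_def)
  have opn: "openin X (fst c)" if "c \<in> At" for c using chart[OF that] by (simp add: is_chart_def)
  have cont': "continuous_map (subtopology X (fst c)) euclidean (\<lambda>p. f c (snd c p))"
    if "c \<in> At" for c
    using continuous_map_compose[OF chart_continuous_map[OF chart[OF that]], of euclidean "f c"]
      cont[OF that] by (simp add: comp_def)
  have compatible': "f c (snd c p) = f d (snd d p)"
    if "c \<in> At" "d \<in> At" "p \<in> topspace X \<inter> fst c \<inter> fst d" for c d p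
    using compatible[OF that(1,2)] that(3) by blast
  obtain F where "continuous_map X euclidean F"
    "\<And>p c. c \<in> At \<Longrightarrow> p \<in> topspace X \<inter> fst c \<Longrightarrow> F p = f c (snd c p)"
    by (rule pasting_lemma_exists[where f = "\<lambda>c p. f c (snd c p)",
          OF equalityD2[OF cover] opn cont' compatible']) blast+
  then show ?thesis using that cover by blast
qed

lemma constant_if_maximum_set_open:
  fixes F :: "'a \<Rightarrow> real"
  assumes X: "compact_space X" "connected_space X" and F: "continuous_map X euclidean F"
    and max_open: "\<And>q. q \<in> topspace X \<Longrightarrow> (\<And>p. p \<in> topspace X \<Longrightarrow> F p \<le> F q)
      \<Longrightarrow> openin X {p \<in> topspace X. F p = F q}"
    and p: "p \<in> topspace X" "p' \<in> topspace X"
  shows "F p = F p'"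
proof -
  have "compact (F ` topspace X)"
    using image_compactin[OF _ F] X(1) by (simp add: compact_space_def)
  then obtain q where q: "q \<in> topspace X" "\<And>p. p \<in> topspace X \<Longrightarrow> F p \<le> F q"
    using compact_attains_sup[of "F ` topspace X"] p(1) by blast
  let ?S = "{p \<in> topspace X. F p = F q}"
  have "openin X ?S" by (rule max_open[OF q])
  moreover have "closedin X ?S" using closedin_continuous_map_preimage[OF F, of "{F q}"] by simp
  moreover have "q \<in> ?S" using q(1) by simp
  ultimately have "?S = topspace X" using X(2) unfolding connected_space_clopen_in by blast
  then have "p \<in> ?S" "p' \<in> ?S" using p by blast+
  then show ?thesis by simp
qed

lemma chart_functions_constant_if_maximum_sets_open:
  fixes f :: "'m chart \<Rightarrow> real^4 \<Rightarrow> real"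
  assumes X: "closed_connected_4manifold X At"
    and cont: "\<And>c. c \<in> At \<Longrightarrow> continuous_on (cdom c) (f c)"
    and compatible: "\<And>c d p. c \<in> At \<Longrightarrow> d \<in> At \<Longrightarrow> p \<in> fst c \<Longrightarrow> p \<in> fst d
      \<Longrightarrow> f c (snd c p) = f d (snd d p)"
    and max_open: "\<And>c M. c \<in> At \<Longrightarrow> M > 0 \<Longrightarrow> (\<And>x. x \<in> cdom c \<Longrightarrow> f c x \<le> M)
      \<Longrightarrow> open {x \<in> cdom c. f c x = M}"
    and c\<^sub>0: "c\<^sub>0 \<in> At" "x\<^sub>0 \<in> cdom c\<^sub>0" "f c\<^sub>0 x\<^sub>0 > 0"
    and c: "c \<in> At" "x \<in> cdom c"
  shows "f c x = f c\<^sub>0 x\<^sub>0"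
proof -
  have atlas: "smooth_atlas X At" using X by (simp add: closed_connected_4manifold_def)
  then have cover: "topspace X = (\<Union>c\<in>At. fst c)" by (simp add: smooth_atlas_def)
  obtain F where F: "continuous_map X euclidean F"
    and F_chart: "\<And>c p. c \<in> At \<Longrightarrow> p \<in> fst c \<Longrightarrow> F p = f c (snd c p)"
    using glue_chart_functions[OF atlas cont compatible] by blast
  have chart_value: "\<exists>p\<in>topspace X. F p = f c x" if "c \<in> At" "x \<in> cdom c" for c x
  proof -
    obtain p where "p \<in> fst c" "x = snd c p" using \<open>x \<in> cdom c\<close> by (auto simp: cdom_def)
    then show ?thesis using F_chart[OF \<open>c \<in> At\<close>] cover \<open>c \<in> At\<close> by auto
  qed
  obtain p\<^sub>0 p where p\<^sub>0: "p\<^sub>0 \<in> topspace X" "F p\<^sub>0 = f c\<^sub>0 x\<^sub>0"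
    and p: "p \<in> topspace X" "F p = f c x"
    using chart_value[OF c\<^sub>0(1,2)] chart_value[OF c] by blast
  have "openin X {p \<in> topspace X. F p = F q}"
    if q: "q \<in> topspace X" "\<And>p. p \<in> topspace X \<Longrightarrow> F p \<le> F q" for q
  proof -
    have "F q > 0" using q(2)[OF p\<^sub>0(1)] p\<^sub>0(2) c\<^sub>0(3) by simp
    have "openin X {p \<in> fst c. snd c p \<in> {x \<in> cdom c. f c x = F q}}" if "c \<in> At" for c
    proof (rule openin_chart_preimage)
      show "open {x \<in> cdom c. f c x = F q}"
        using chart_value[OF that] q(2) by (intro max_open[OF that \<open>F q > 0\<close>]) metis
    qed (use atlas that in \<open>auto simp: smooth_atlas_def\<close>)
    then have "openin X (\<Union>c\<in>At. {p \<in> fst c. snd c p \<in> {x \<in> cdom c. f c x = F q}})" by blast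
    also have "(\<Union>c\<in>At. {p \<in> fst c. snd c p \<in> {x \<in> cdom c. f c x = F q}}) =
        {p \<in> topspace X. F p = F q}"
      using cover F_chart by (auto simp: cdom_def)
    finally show ?thesis .
  qed
  then have "F p = F p\<^sub>0"
    using constant_if_maximum_set_open[OF _ _ F _ p(1) p\<^sub>0(1)] X
    by (simp add: closed_connected_4manifold_def)
  then show ?thesis using p\<^sub>0(2) p(2) by simp
qed

lemma im_square_chart_independent:
  assumes "smooth_atlas X At" "pseudo_metric At G" "smooth_11_field At A"
    and c: "c \<in> At" and d: "d \<in> At" and p: "p \<in> fst c" "p \<in> fst d"
  shows "im_square (A c (snd c p)) = im_square (A d (snd d p))"
proof -
  let ?x = "snd c p"
  let ?P = "jac (trans_map c d) ?x"
  have "inj_on (snd c) (fst c)"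
    using chart_inj_on[of X c] assms(1) c by (simp add: smooth_atlas_def)
  then have x: "?x \<in> overlap c d" "trans_map c d ?x = snd d p"
    using p by (auto simp: overlap_def trans_map_def)
  have "A d (snd d p) ** ?P = ?P ** A c ?x"
    using assms(3) c d x unfolding smooth_11_field_def by metis
  moreover have "G c ?x = transpose ?P ** G d (snd d p) ** ?P"
    using assms(2) c d x unfolding pseudo_metric_def smooth_02_field_def by metis
  then have "det (G c ?x) = det ?P * det (G d (snd d p)) * det ?P" by (simp add: det_mul)
  then have "det ?P \<noteq> 0" using assms(2) c p by (auto simp: pseudo_metric_def cdom_def)
  ultimately show ?thesis by (rule im_square_similar[symmetric])
qed

lemma im_square_constant:
  assumes X: "closed_connected_4manifold X At" and kaehler: "kaehler_surface X At G J"
    and A: "in_AgJ At G J A"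
    and pos: "c\<^sub>0 \<in> At" "x\<^sub>0 \<in> cdom c\<^sub>0" "im_square (A c\<^sub>0 x\<^sub>0) > 0"
    and c: "c \<in> At" "x \<in> cdom c"
  shows "im_square (A c x) = im_square (A c\<^sub>0 x\<^sub>0)"
proof (rule chart_functions_constant_if_maximum_sets_open
    [where f = "\<lambda>c x. im_square (A c x)", OF X _ _ _ pos c])
  have atlas: "smooth_atlas X At" using X by (simp add: closed_connected_4manifold_def)
  fix c assume c: "c \<in> At"
  interpret local_solution "cdom c" "G c" "J c" "A c"
    by (rule local_solution_chart[OF atlas kaehler A c])
  show "continuous_on (cdom c) (\<lambda>x. im_square (A c x))" by (rule continuous_on_E)
  show "open {x \<in> cdom c. im_square (A c x) = M}"
    if "M > 0" "\<And>x. x \<in> cdom c \<Longrightarrow> im_square (A c x) \<le> M" for M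
    by (rule open_level_set_of_positive_maximum[OF that])
  have "pseudo_metric At G" "smooth_11_field At A"
    using kaehler A by (simp_all add: kaehler_surface_def in_AgJ_def)
  then show "im_square (A c (snd c p)) = im_square (A d (snd d p))"
    if "d \<in> At" "p \<in> fst c" "p \<in> fst d" for d p
    by (rule im_square_chart_independent[OF atlas _ _ c that])
qed

theorem theorem5p1:
  fixes X :: "'m topology" and At :: "'m chart set"
    and G J A :: "'m chart \<Rightarrow> real^4 \<Rightarrow> real^4^4"
  assumes "closed_connected_4manifold X At"
    and "kaehler_surface X At G J"
    and "in_AgJ At G J A"
    and "\<exists>c\<in>At. \<exists>x\<in>cdom c. \<exists>\<rho>. Im \<rho> \<noteq> 0 \<and> complex_eigenvalue (A c x) \<rho>"
  shows "\<forall>c\<in>At. \<forall>x\<in>cdom c. \<forall>i. covd (G c) (A c) x i = 0"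
proof -
  have atlas: "smooth_atlas X At" using assms(1) by (simp add: closed_connected_4manifold_def)
  note solution = local_solution_chart[OF atlas assms(2,3)]
  obtain c\<^sub>0 x\<^sub>0 where pos: "c\<^sub>0 \<in> At" "x\<^sub>0 \<in> cdom c\<^sub>0" "im_square (A c\<^sub>0 x\<^sub>0) > 0"
    using assms(4) hermitian_endomorphism.im_square_pos local_solution.hermitian[OF solution]
    by blast
  have "im_square (A c x) = im_square (A c\<^sub>0 x\<^sub>0)" if "c \<in> At" "x \<in> cdom c" for c x
    by (rule im_square_constant[OF assms(1-3) pos that])
  then show ?thesis
    using local_solution.parallel_if_im_square_constant[OF solution] pos(3)
    by (metis less_irrefl)
qed

end
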